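(* Let $W$ be an entanglement witness on $\mathscr{H}=\bigotimes_{k=1}^m\mathbb{C}^{d_k}$, and let $W_+,W_-$ be the orthogonal positive-semidefinite operators satisfying $W=W_+-W_-$. Let $\mathscr{E}=\{\eta_i,\rho_i\}_{i=1}^2$ be the ensemble of two orthogonal states $$\eta_1=\frac{\operatorname{Tr}W_-}{\operatorname{Tr}W_++\operatorname{Tr}W_-},\quad\rho_1=\frac{W_-}{\operatorname{Tr}W_-},\quad \eta_2=\frac{\operatorname{Tr}W_+}{\operatorname{Tr}W_++\operatorname{Tr}W_-},\quad\rho_2=\frac{W_+}{\operatorname{Tr}W_+}.$$ Then $$\mathcal{Q}_1(\mathscr{E})\leqslant\tfrac12<\mathcal{C}_1(\mathscr{E})=1.$$ In particular, the maximum confidence of measurements to identify $\rho_1$ is nonlocal, i.e. $\mathcal{L}_1(\mathscr{E})<\mathcal{C}_1(\mathscr{E})$.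
   Context: Let $\mathscr{H}=\bigotimes_{k=1}^m\mathbb{C}^{d_k}$ with $m\geqslant 2$ and positive integers $d_1,\ldots,d_m$. $\mathbb{H}$ is the set of Hermitian operators on $\mathscr{H}$, and $\mathbb{H}_+\subseteq\mathbb{H}$ is the set of positive-semidefinite ones. A state is $\rho\in\mathbb{H}_+$ with $\operatorname{Tr}\rho=1$. An ensemble $\{\eta_i,\rho_i\}_{i=1}^n$ consists of states $\rho_i$ with nonzero probabilities $\eta_i$ (so $\eta_i>0$, $\sum_i\eta_i=1$), and $\rho_0=\sum_{i=1}^n\eta_i\rho_i$. An operator $E\in\mathbb{H}_+$ is separable if $E=\sum_l p_l\bigotimes_{k=1}^m\sigma_l^{(k)}$ with $p_l\geqslant 0$ and $\sigma_l^{(k)}$ states on $\mathbb{C}^{d_k}$; $\mathbb{SEP}$ is the set of all separable operators. An operator $E\in\mathbb{H}$ is block positive if $\operatorname{Tr}(EF)\geqslant0$ for all $F\in\mathbb{SEP}$; $\mathbb{SEP}^*$ is the set of all block-positive operators. An entanglement witness is an element of $\mathbb{SEP}^*\setminus\mathbb{H}_+$. A measurement is a family $\mathscr{M}=\{M_i\}_{i=0}^n\subseteq\mathbb{H}_+$ with $\sum_iM_i=\mathbb{1}$. It is an LOCC measurement if it can be realized by local operations and classical communication, i.e. by a protocol in which the $m$ parties perform local quantum operations and measurements on their own subsystems (possibly using randomness and depending on previously communicated messages), exchange classical messages, and determine the final outcome from the classical record. Every LOCC measurement has all $M_i\in\mathbb{SEP}$. When $\operatorname{Tr}(\rho_0M_j)\neq0$,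 the confidence to identify $\rho_j$ is $\Pr(\rho_j|M_j)=\dfrac{\eta_j\operatorname{Tr}(\rho_jM_j)}{\operatorname{Tr}(\rho_0M_j)}$. $\mathcal{C}_j(\mathscr{E})$ (resp. $\mathcal{L}_j(\mathscr{E})$) is the maximum of $\Pr(\rho_j|M_j)$ over all measurements (resp. all LOCC measurements) with $\operatorname{Tr}(\rho_0M_j)\neq0$. The maximum confidence to identify $\rho_j$ is called nonlocal if $\mathcal{L}_j(\mathscr{E})<\mathcal{C}_j(\mathscr{E})$. $\mathcal{Q}_j(\mathscr{E})=\min\{q\in\mathbb{R}\mid q\rho_0-\eta_j\rho_j\in\mathbb{SEP}^*\}$. *)

theory Defs
  imports "Jordan_Normal_Form.Schur_Decomposition"
begin

section \<open>Operators on finite-dimensional complex Hilbert spaces\<close>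

definition mtrace :: "complex mat \<Rightarrow> complex" where
  "mtrace A = (\<Sum>i<dim_row A. A $$ (i, i))"

(* The sum of a family of matrices; the library has no such sum because matrices of
   varying dimension share one type. *)
definition msum :: "nat \<Rightarrow> nat \<Rightarrow> 'i set \<Rightarrow> ('i \<Rightarrow> complex mat) \<Rightarrow> complex mat" where
  "msum r c I A = mat r c (\<lambda>(a, b). \<Sum>i\<in>I. A i $$ (a, b))"

definition hermitian :: "nat \<Rightarrow> complex mat \<Rightarrow> bool" where
  "hermitian d A \<longleftrightarrow> A \<in> carrier_mat d d \<and> mat_adjoint A = A"

definition psd :: "nat \<Rightarrow> complex mat \<Rightarrow> bool" where
  "psd d A \<longleftrightarrow> hermitian d A \<and> (\<forall>v\<in>carrier_vec d. 0 \<le> (A *\<^sub>v v) \<bullet>c v)"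

definition state :: "nat \<Rightarrow> complex mat \<Rightarrow> bool" where
  "state d \<rho> \<longleftrightarrow> psd d \<rho> \<and> mtrace \<rho> = 1"

definition kron :: "complex mat \<Rightarrow> complex mat \<Rightarrow> complex mat" where
  "kron A B = mat (dim_row A * dim_row B) (dim_col A * dim_col B)
     (\<lambda>(i, j). A $$ (i div dim_row B, j div dim_col B) * B $$ (i mod dim_row B, j mod dim_col B))"

definition kron_list :: "complex mat list \<Rightarrow> complex mat" where
  "kron_list As = foldr kron As (1\<^sub>m 1)"

section \<open>Separability and entanglement witnesses\<close>

(* A multipartite space is given by the list ds of its local dimensions. Its operators are
   matrices in the product basis, of size prod_list ds. *)

abbreviation hdim :: "nat list \<Rightarrow> nat" where
  "hdim ds \<equiv> prod_list ds"

definition SEP :: "nat list \<Rightarrow> complex mat set" where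
  "SEP ds = {E. psd (hdim ds) E \<and>
     (\<exists>(L :: nat) (p :: nat \<Rightarrow> real) (\<sigma> :: nat \<Rightarrow> nat \<Rightarrow> complex mat).
        (\<forall>l<L. 0 \<le> p l \<and> (\<forall>k<length ds. state (ds ! k) (\<sigma> l k))) \<and>
        E = msum (hdim ds) (hdim ds) {..<L}
              (\<lambda>l. complex_of_real (p l) \<cdot>\<^sub>m kron_list (map (\<sigma> l) [0..<length ds])))}"

definition block_positive :: "nat list \<Rightarrow> complex mat set" where
  "block_positive ds = {E. hermitian (hdim ds) E \<and> (\<forall>F\<in>SEP ds. 0 \<le> mtrace (E * F))}"

definition entanglement_witness :: "nat list \<Rightarrow> complex mat \<Rightarrow> bool" where
  "entanglement_witness ds W \<longleftrightarrow> W \<in> block_positive ds - {E. psd (hdim ds) E}"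

section \<open>Ensembles and measurements\<close>

definition ensemble :: "nat list \<Rightarrow> nat \<Rightarrow> (nat \<Rightarrow> real) \<Rightarrow> (nat \<Rightarrow> complex mat) \<Rightarrow> bool" where
  "ensemble ds n \<eta> \<rho> \<longleftrightarrow>
     (\<forall>i\<in>{1..n}. 0 < \<eta> i \<and> state (hdim ds) (\<rho> i)) \<and> (\<Sum>i=1..n. \<eta> i) = 1"

definition avg_state :: "nat list \<Rightarrow> nat \<Rightarrow> (nat \<Rightarrow> real) \<Rightarrow> (nat \<Rightarrow> complex mat) \<Rightarrow> complex mat" where
  "avg_state ds n \<eta> \<rho> =
     msum (hdim ds) (hdim ds) {1..n} (\<lambda>i. complex_of_real (\<eta> i) \<cdot>\<^sub>m \<rho> i)"

definition measurement :: "nat list \<Rightarrow> nat \<Rightarrow> (nat \<Rightarrow> complex mat) \<Rightarrow> bool" where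
  "measurement ds n M \<longleftrightarrow>
     (\<forall>i\<le>n. psd (hdim ds) (M i)) \<and> msum (hdim ds) (hdim ds) {..n} M = 1\<^sub>m (hdim ds)"

section \<open>Local operations and classical communication\<close>

(* A quantum instrument with classical outcomes x < length I on a d-dimensional system:
   I ! x = (e, Ks) stands for the completely positive map
   \<rho> \<mapsto> (\<Sum>K\<in>Ks. K \<rho> K\<^sup>\<dagger>) into dimension e, and the sum of these
   maps preserves the trace. The output dimension may depend on x, so attaching and discarding
   ancillas is covered; local randomness is an instrument of multiples of the identity. *)
definition instrument :: "nat \<Rightarrow> (nat \<times> complex mat list) list \<Rightarrow> bool" where
  "instrument d I \<longleftrightarrow>
     (\<forall>(e, Ks)\<in>set I. 0 < e \<and> set Ks \<subseteq> carrier_mat e d) \<and>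
     msum d d (SIGMA x:{..<length I}. {..<length (snd (I ! x))})
       (\<lambda>(x, a). mat_adjoint (snd (I ! x) ! a) * (snd (I ! x) ! a)) = 1\<^sub>m d"

(* The operator K acting on party k, tensored with the identity on all other parties. *)
definition local_op :: "nat list \<Rightarrow> nat \<Rightarrow> complex mat \<Rightarrow> complex mat" where
  "local_op ds k K = kron_list ((map 1\<^sub>m ds)[k := K])"

(* realizes_locc n ds M: some finite protocol on parties with local dimensions ds has the
   measurement operators M 0, ..., M n. Either the protocol stops and announces an outcome c, or
   some party k applies an instrument to its subsystem, broadcasts the classical outcome x, and
   the parties go on with a protocol for N x that may depend on x (hence, along a branch, on the
   whole classical record). In the Heisenberg picture the operator of outcome i is then the
   pullback of the operators N x i under the chosen instrument. Broadcasting
   every outcome loses no generality: later steps may ignore it, and an outcome that is not to be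
   sent at all is modelled by several Kraus operators in one branch. *)
inductive realizes_locc :: "nat \<Rightarrow> nat list \<Rightarrow> (nat \<Rightarrow> complex mat) \<Rightarrow> bool" for n where
  stop: "realizes_locc n ds M"
    if "c \<le> n"
      and "\<forall>i\<le>n. M i = (if i = c then 1\<^sub>m (hdim ds) else 0\<^sub>m (hdim ds) (hdim ds))"
| step: "realizes_locc n ds M"
    if "k < length ds" and "instrument (ds ! k) I"
      and "\<forall>x<length I. realizes_locc n (ds[k := fst (I ! x)]) (N x)"
      and "\<forall>i\<le>n. M i = msum (hdim ds) (hdim ds)
             (SIGMA x:{..<length I}. {..<length (snd (I ! x))})
             (\<lambda>(x, a). mat_adjoint (local_op ds k (snd (I ! x) ! a)) * N x i
                        * local_op ds k (snd (I ! x) ! a))"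

definition locc_measurement :: "nat list \<Rightarrow> nat \<Rightarrow> (nat \<Rightarrow> complex mat) \<Rightarrow> bool" where
  "locc_measurement ds n M \<longleftrightarrow> measurement ds n M \<and> realizes_locc n ds M"

section \<open>Confidence\<close>

definition confidence ::
  "nat list \<Rightarrow> nat \<Rightarrow> (nat \<Rightarrow> real) \<Rightarrow> (nat \<Rightarrow> complex mat) \<Rightarrow> nat \<Rightarrow> (nat \<Rightarrow> complex mat) \<Rightarrow> real" where
  "confidence ds n \<eta> \<rho> j M =
     \<eta> j * Re (mtrace (\<rho> j * M j)) / Re (mtrace (avg_state ds n \<eta> \<rho> * M j))"

definition max_confidence ::
  "nat list \<Rightarrow> nat \<Rightarrow> (nat \<Rightarrow> real) \<Rightarrow> (nat \<Rightarrow> complex mat) \<Rightarrow> nat \<Rightarrow> real" where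
  "max_confidence ds n \<eta> \<rho> j =
     (GREATEST c. \<exists>M. measurement ds n M \<and> mtrace (avg_state ds n \<eta> \<rho> * M j) \<noteq> 0 \<and>
        c = confidence ds n \<eta> \<rho> j M)"

(* A supremum, since the set of LOCC measurements is not closed and the maximum need not be
   attained; it is the maximum whenever that exists. *)
definition locc_max_confidence ::
  "nat list \<Rightarrow> nat \<Rightarrow> (nat \<Rightarrow> real) \<Rightarrow> (nat \<Rightarrow> complex mat) \<Rightarrow> nat \<Rightarrow> real" where
  "locc_max_confidence ds n \<eta> \<rho> j =
     Sup {confidence ds n \<eta> \<rho> j M | M.
        locc_measurement ds n M \<and> mtrace (avg_state ds n \<eta> \<rho> * M j) \<noteq> 0}"

definition nonlocal_max_confidence ::
  "nat list \<Rightarrow> nat \<Rightarrow> (nat \<Rightarrow> real) \<Rightarrow> (nat \<Rightarrow> complex mat) \<Rightarrow> nat \<Rightarrow> bool" where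
  "nonlocal_max_confidence ds n \<eta> \<rho> j \<longleftrightarrow>
     locc_max_confidence ds n \<eta> \<rho> j < max_confidence ds n \<eta> \<rho> j"

definition Q_bound ::
  "nat list \<Rightarrow> nat \<Rightarrow> (nat \<Rightarrow> real) \<Rightarrow> (nat \<Rightarrow> complex mat) \<Rightarrow> nat \<Rightarrow> real" where
  "Q_bound ds n \<eta> \<rho> j =
     (LEAST q. complex_of_real q \<cdot>\<^sub>m avg_state ds n \<eta> \<rho> - complex_of_real (\<eta> j) \<cdot>\<^sub>m \<rho> j
        \<in> block_positive ds)"

end

theory Submission
  imports Defs
begin

text \<open>
  With \<open>T = Tr W\<^sub>+ + Tr W\<^sub>-\<close>, the average state is \<open>(W\<^sub>+ + W\<^sub>-) / T\<close>, and the confidence of \<open>M\<close> in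
  \<open>\<rho>\<^sub>1\<close> is \<open>b / (a + b)\<close> for \<open>a = Tr (W\<^sub>+ M\<^sub>1)\<close> and \<open>b = Tr (W\<^sub>- M\<^sub>1)\<close>. It equals 1 when \<open>M\<^sub>1\<close> is a small
  multiple of \<open>W\<^sub>-\<close>, by orthogonality. For an LOCC measurement, block positivity gives
  \<open>a - b = Tr (W M\<^sub>1) \<ge> 0\<close>, hence confidence at most 1/2. The bound on \<open>Q\<^sub>1\<close> is the identity
  \<open>\<rho>\<^sub>0 / 2 - \<eta>\<^sub>1 \<rho>\<^sub>1 = W / (2 T)\<close>.
\<close>

section \<open>Positive-semidefinite kernels\<close>

text \<open>The positivity facts rest on one inequality: \<open>Tr (A B)\<close> is nonnegative for
  positive-semidefinite \<open>A\<close> and \<open>B\<close>. It is obtained from Schur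
  complements, so neither eigenvectors nor square roots are needed, and it also yields the
  positivity of Kronecker products. Both parts of the witness property are needed to make the
  ensemble meaningful. Since \<open>W\<close> is not positive semidefinite, \<open>Wm\<close> is
  nonzero; since \<open>W\<close> pairs nonnegatively with the separable identity,
  \<open>Tr Wp\<close> is at least \<open>Tr Wm\<close>, hence positive as well. The extremal
  quantities need separate care. \<open>Q_bound\<close> is a \<open>LEAST\<close> over the reals, so
  its minimum has to be attained before any bound on it means something.
  \<open>locc_max_confidence\<close> is a \<open>Sup\<close> of a set that has to be nonempty; the
  inequality with 1 remains strict in the supremum because 1/2 bounds all LOCC confidences
  uniformly.\<close>

definition qform :: "nat \<Rightarrow> (nat \<Rightarrow> nat \<Rightarrow> complex) \<Rightarrow> (nat \<Rightarrow> complex) \<Rightarrow> complex" where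
  "qform d f x = (\<Sum>i<d. \<Sum>j<d. f i j * x j * cnj (x i))"

text \<open>Kernels are plain functions, so that Schur complements and partial contractions can be
  written as lambda terms without carrier conditions. Only values at indices below \<open>d\<close>
  matter.\<close>

definition psd_kernel :: "nat \<Rightarrow> (nat \<Rightarrow> nat \<Rightarrow> complex) \<Rightarrow> bool" where
  "psd_kernel d f \<longleftrightarrow> (\<forall>i<d. \<forall>j<d. f j i = cnj (f i j)) \<and> (\<forall>x. 0 \<le> qform d f x)"

section \<open>Adjoints, and the passage between matrices and kernels\<close>

lemma complex_divide_nonneg: "0 \<le> z \<Longrightarrow> 0 \<le> w \<Longrightarrow> 0 \<le> z / (w :: complex)"
  by (auto simp: less_eq_complex_def Re_divide Im_divide)

lemma dim_mat_adjoint [simp]: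
  "dim_row (mat_adjoint A) = dim_col A" "dim_col (mat_adjoint A) = dim_row A"
  by (auto simp: mat_adjoint_def)

lemma index_mat_adjoint [simp]:
  fixes A :: "complex mat"
  shows "i < dim_col A \<Longrightarrow> j < dim_row A \<Longrightarrow> mat_adjoint A $$ (i, j) = cnj (A $$ (j, i))"
  by (auto simp: mat_adjoint_def mat_of_rows_index)

lemma mat_adjoint_carrier [simp, intro]:
  "A \<in> carrier_mat r c \<Longrightarrow> mat_adjoint A \<in> carrier_mat c r"
  by auto

lemma quadratic_form_eq_qform:
  assumes "A \<in> carrier_mat d d" "v \<in> carrier_vec d"
  shows "(A *\<^sub>v v) \<bullet>c v = qform d (\<lambda>i j. A $$ (i, j)) (\<lambda>i. v $ i)"
  using assms by (auto simp: qform_def scalar_prod_def lessThan_atLeast0 sum_distrib_right intro!: sum.cong)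

lemma hermitian_iff:
  "hermitian d A \<longleftrightarrow> A \<in> carrier_mat d d \<and> (\<forall>i<d. \<forall>j<d. A $$ (j, i) = cnj (A $$ (i, j)))"
  (is "_ \<longleftrightarrow> ?R")
proof
  assume h: "hermitian d A"
  have "A $$ (j, i) = cnj (A $$ (i, j))" if "i < d" "j < d" for i j
    using h that index_mat_adjoint[of j A i] by (auto simp: hermitian_def)
  with h show ?R unfolding hermitian_def by blast
next
  assume R: ?R
  have "mat_adjoint A $$ (i, j) = A $$ (i, j)" if "i < d" "j < d" for i j
  proof -
    have "A $$ (i, j) = cnj (A $$ (j, i))" "A \<in> carrier_mat d d"
      using R that by blast+
    then show ?thesis using that by simp
  qed
  moreover have "A \<in> carrier_mat d d" using R by blast
  ultimately show "hermitian d A"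
    by (auto simp: hermitian_def intro!: eq_matI)
qed

lemma psd_iff_psd_kernel:
  "psd d A \<longleftrightarrow> A \<in> carrier_mat d d \<and> psd_kernel d (\<lambda>i j. A $$ (i, j))"
proof -
  have "(\<forall>v\<in>carrier_vec d. 0 \<le> (A *\<^sub>v v) \<bullet>c v) \<longleftrightarrow> (\<forall>x. 0 \<le> qform d (\<lambda>i j. A $$ (i, j)) x)"
    if A: "A \<in> carrier_mat d d"
  proof
    assume *: "\<forall>v\<in>carrier_vec d. 0 \<le> (A *\<^sub>v v) \<bullet>c v"
    have "0 \<le> qform d (\<lambda>i j. A $$ (i, j)) x" for x
      using *[rule_format, of "vec d x"] quadratic_form_eq_qform[OF A, of "vec d x"]
      by (simp add: qform_def)
    then show "\<forall>x. 0 \<le> qform d (\<lambda>i j. A $$ (i, j)) x" ..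
  qed (simp add: quadratic_form_eq_qform[OF A])
  then show ?thesis
    by (auto simp: psd_def hermitian_iff psd_kernel_def)
qed

section \<open>Quadratic forms, Schur complements and the trace pairing\<close>

lemma psd_kernel_herm: "psd_kernel d f \<Longrightarrow> i < d \<Longrightarrow> j < d \<Longrightarrow> f j i = cnj (f i j)"
  unfolding psd_kernel_def by blast

lemma qform_nonneg: "psd_kernel d f \<Longrightarrow> 0 \<le> qform d f x"
  by (simp add: psd_kernel_def)

text \<open>Expansion along one coordinate direction. The later inequalities differ only in the
  choice of point and step: the origin with \<open>t = 1\<close> isolates a diagonal entry, a unit
  vector with a long step makes the form negative, and the minimizing step completes the
  square.\<close>

lemma qform_update:
  assumes herm: "\<And>k. k < d \<Longrightarrow> f k i = cnj (f i k)" and i: "i < d"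
  shows "qform d f (\<lambda>k. x k + (if k = i then t else 0)) =
    qform d f x + cnj t * (\<Sum>k<d. f i k * x k) + t * cnj (\<Sum>k<d. f i k * x k) + t * cnj t * f i i"
proof -
  let ?\<delta> = "\<lambda>k. if k = i then t else 0"
  have "qform d f (\<lambda>k. x k + ?\<delta> k) = (\<Sum>k<d. \<Sum>l<d. f k l * x l * cnj (x k))
      + (\<Sum>k<d. \<Sum>l<d. f k l * x l * cnj (?\<delta> k))
      + (\<Sum>k<d. \<Sum>l<d. f k l * ?\<delta> l * cnj (x k))
      + (\<Sum>k<d. \<Sum>l<d. f k l * ?\<delta> l * cnj (?\<delta> k))"
    unfolding qform_def by (simp add: algebra_simps sum.distrib del: sum.delta sum.delta' cong: if_cong)
  also have "(\<Sum>k<d. \<Sum>l<d. f k l * x l * cnj (?\<delta> k)) = (\<Sum>k<d. if k = i then cnj t * (\<Sum>l<d. f i l * x l) else 0)"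
    by (rule sum.cong) (auto simp: sum_distrib_left mult_ac)
  also have "\<dots> = cnj t * (\<Sum>l<d. f i l * x l)"
    using i by simp
  also have "(\<Sum>k<d. \<Sum>l<d. f k l * ?\<delta> l * cnj (x k)) = (\<Sum>k<d. f k i * t * cnj (x k))"
    using i by (simp add: if_distrib[of "\<lambda>z. _ * z"] if_distrib[of "\<lambda>z. z * _"] cong: if_cong)
  also have "\<dots> = (\<Sum>k<d. t * cnj (f i k * x k))"
    by (rule sum.cong) (auto simp: herm)
  also have "\<dots> = t * cnj (\<Sum>k<d. f i k * x k)"
    by (simp add: sum_distrib_left)
  also have "(\<Sum>k<d. \<Sum>l<d. f k l * ?\<delta> l * cnj (?\<delta> k)) = (\<Sum>k<d. if k = i then f i i * t * cnj t else 0)"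
    using i by (intro sum.cong) (auto simp: if_distrib[of "\<lambda>z. _ * z"] if_distrib[of "\<lambda>z. z * _"] cong: if_cong)
  also have "\<dots> = t * cnj t * f i i"
    using i by simp
  finally show ?thesis by (simp add: qform_def)
qed

lemma psd_kernel_diag_nonneg:
  assumes "psd_kernel d f" "i < d"
  shows "0 \<le> f i i"
proof -
  have "qform d f (\<lambda>k. 0 + (if k = i then 1 else 0)) = f i i"
    using assms(2) by (subst qform_update[OF psd_kernel_herm[OF assms(1)]]) (auto simp: qform_def)
  with qform_nonneg[OF assms(1), of "\<lambda>k. 0 + (if k = i then 1 else 0)"] show ?thesis by argo
qed

text \<open>With \<open>f i i = 0\<close> the form at \<open>e_j + t e_i\<close> has no quadratic
  term in \<open>t\<close>; a nonzero \<open>f i j\<close> would make it unbounded below.\<close>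

lemma psd_kernel_zero_diag:
  assumes f: "psd_kernel d f" and ij: "i < d" "j < d" and "f i i = 0"
  shows "f i j = 0"
proof (rule ccontr)
  assume nz: "f i j \<noteq> 0"
  define x :: "nat \<Rightarrow> complex" where "x k = 0 + (if k = j then 1 else 0)" for k
  have 1: "(\<Sum>k<d. f i k * x k) = f i j"
    using ij by (simp add: x_def if_distrib[of "\<lambda>z. _ * z"] cong: if_cong)
  have 2: "qform d f x = f j j"
    unfolding x_def using ij by (subst qform_update[OF psd_kernel_herm[OF f]]) (auto simp: qform_def)
  \<comment> \<open>This value makes the form equal to -1 in its real part: the two linear terms
    contribute \<open>- 2 * r * (cmod (f i j))\<^sup>2\<close>, which is
    \<open>- (Re (f j j) + 1)\<close>.\<close>
  define r where "r = (Re (f j j) + 1) / (2 * (cmod (f i j))\<^sup>2)"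
  have r: "2 * r * (cmod (f i j))\<^sup>2 = Re (f j j) + 1"
    using nz by (simp add: r_def)
  define t where "t = - (of_real r * f i j)"
  have "qform d f (\<lambda>k. x k + (if k = i then t else 0)) = f j j + cnj t * f i j + t * cnj (f i j)"
    using ij \<open>f i i = 0\<close> by (subst qform_update[OF psd_kernel_herm[OF f]]) (auto simp: 1 2)
  also have "Re \<dots> = Re (f j j) - 2 * r * (cmod (f i j))\<^sup>2"
    unfolding cmod_power2 by (simp add: t_def power2_eq_square algebra_simps)
  also have "\<dots> = -1" by (simp add: r)
  finally show False
    using qform_nonneg[OF f, of "\<lambda>k. x k + (if k = i then t else 0)"]
    by (simp add: less_eq_complex_def)
qed

text \<open>Completing the square: the reduced form at \<open>x\<close> is the form of
  \<open>f\<close> at \<open>x\<close> shifted along coordinate \<open>i\<close> by the minimizing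
  step \<open>- u / f i i\<close>, where \<open>u\<close> is the \<open>i\<close>-th entry of
  \<open>f\<close> applied to \<open>x\<close>.\<close>

lemma psd_kernel_schur_complement:
  assumes f: "psd_kernel d f" and i: "i < d" and "f i i \<noteq> 0"
  shows "psd_kernel d (\<lambda>j k. f j k - f j i * f i k / f i i)"
  unfolding psd_kernel_def
proof (intro conjI allI impI)
  have real: "cnj (f i i) = f i i"
    using psd_kernel_herm[OF f i i] by simp
  show "f k j - f k i * f i j / f i i = cnj (f j k - f j i * f i k / f i i)" if "j < d" "k < d" for j k
  proof -
    have "f k j = cnj (f j k)" "f k i = cnj (f i k)" "f i j = cnj (f j i)"
      using i that by (auto intro: psd_kernel_herm[OF f])
    then show ?thesis by (simp add: real)
  qed
  fix x
  define u where "u = (\<Sum>k<d. f i k * x k)"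
  have "qform d (\<lambda>j k. f j k - f j i * f i k / f i i) x
      = qform d f x - (\<Sum>j<d. \<Sum>k<d. (f j i * cnj (x j)) * (f i k * x k)) / f i i"
    unfolding qform_def sum_divide_distrib sum_subtractf[symmetric]
    by (intro sum.cong refl) (simp add: algebra_simps)
  also have "(\<Sum>j<d. \<Sum>k<d. (f j i * cnj (x j)) * (f i k * x k)) = (\<Sum>j<d. f j i * cnj (x j)) * u"
    by (simp add: u_def sum_product)
  also have "(\<Sum>j<d. f j i * cnj (x j)) = cnj u"
    unfolding u_def cnj_sum
  proof (intro sum.cong refl)
    show "f j i * cnj (x j) = cnj (f i j * x j)" if "j \<in> {..<d}" for j
      using psd_kernel_herm[OF f i, of j] that by simp
  qed
  also have "qform d f x - cnj u * u / f i i
      = qform d f (\<lambda>k. x k + (if k = i then - u / f i i else 0))"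
    using qform_update[of d f i x "- u / f i i", OF psd_kernel_herm[OF f i] i, folded u_def] \<open>f i i \<noteq> 0\<close>
    by (simp add: real mult.commute)
  also have "0 \<le> \<dots>" by (rule qform_nonneg[OF f])
  finally show "0 \<le> qform d (\<lambda>j k. f j k - f j i * f i k / f i i) x" .
qed

text \<open>
  Taking Schur complements peels rank-one kernels off \<open>f\<close>, each of which contributes a value of
  the quadratic form of \<open>g\<close>.
\<close>

lemma psd_kernel_pairing_nonneg:
  assumes "psd_kernel d f" "psd_kernel d g"
  shows "0 \<le> (\<Sum>j<d. \<Sum>k<d. f j k * g k j)"
  using assms(1)
\<comment> \<open>The count of nonzero diagonal entries drops, since the Schur complement at
  \<open>i\<close> clears the entry at \<open>i\<close> and keeps every zero diagonal entry zero.
  When no nonzero entry is left, the whole kernel vanishes.\<close>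
proof (induction "card {i. i < d \<and> f i i \<noteq> 0}" arbitrary: f rule: less_induct)
  case less
  show ?case
  proof (cases "\<exists>i<d. f i i \<noteq> 0")
    case False
    then have "f j k = 0" if "j < d" "k < d" for j k
      using psd_kernel_zero_diag[OF less.prems] that by blast
    then show ?thesis by simp
  next
    case True
    then obtain i where i: "i < d" "f i i \<noteq> 0" by blast
    let ?h = "\<lambda>j k. f j k - f j i * f i k / f i i"
    have imp: "?h j j = 0" if "j < d" "f j j = 0" for j
      using psd_kernel_zero_diag[OF less.prems _ i(1), of j] that by simp
    have "?h i i = 0" using i by simp
    then have "{j. j < d \<and> ?h j j \<noteq> 0} \<subset> {j. j < d \<and> f j j \<noteq> 0}"
      using imp i by blast
    then have "card {j. j < d \<and> ?h j j \<noteq> 0} < card {j. j < d \<and> f j j \<noteq> 0}"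
      by (intro psubset_card_mono) auto
    then have h: "0 \<le> (\<Sum>j<d. \<Sum>k<d. ?h j k * g k j)"
      by (rule less.hyps) (rule psd_kernel_schur_complement[OF less.prems i])
    have "(\<Sum>j<d. \<Sum>k<d. f j k * g k j)
        = (\<Sum>j<d. \<Sum>k<d. ?h j k * g k j) + (\<Sum>j<d. \<Sum>k<d. g k j * f j i * f i k) / f i i"
      unfolding sum_divide_distrib sum.distrib[symmetric]
      by (intro sum.cong refl) (simp add: algebra_simps)
    also have "(\<Sum>j<d. \<Sum>k<d. g k j * f j i * f i k) = (\<Sum>k<d. \<Sum>j<d. g k j * f j i * f i k)"
      by (rule sum.swap)
    also have "\<dots> = qform d g (\<lambda>j. f j i)"
      unfolding qform_def
    proof (intro sum.cong refl)
      show "g k j * f j i * f i k = g k j * f j i * cnj (f k i)"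
        if "k \<in> {..<d}" for k j
        using psd_kernel_herm[OF less.prems _ i(1), of k] that by simp
    qed
    also have "0 \<le> (\<Sum>j<d. \<Sum>k<d. ?h j k * g k j) + \<dots> / f i i"
      using h assms(2) psd_kernel_diag_nonneg[OF less.prems i(1)]
      by (intro add_nonneg_nonneg complex_divide_nonneg qform_nonneg)
    finally show ?thesis .
  qed
qed

section \<open>Kronecker products of kernels\<close>

lemma sum_div_mod:
  fixes h :: "nat \<Rightarrow> nat \<Rightarrow> 'a::comm_monoid_add"
  shows "(\<Sum>k<m * n. h (k div n) (k mod n)) = (\<Sum>a<m. \<Sum>b<n. h a b)"
proof -
  have "(\<Sum>k<m * n. h (k div n) (k mod n)) = (\<Sum>a<m. \<Sum>k\<in>{a * n..<a * n + n}. h (k div n) (k mod n))"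
    by (rule sum.nat_group[symmetric])
  moreover have "(\<Sum>k\<in>{a * n..<a * n + n}. h (k div n) (k mod n)) = (\<Sum>b<n. h a b)" for a
  proof -
    have "(\<Sum>b<n. h ((a * n + b) div n) ((a * n + b) mod n)) = (\<Sum>b<n. h a b)"
      by (intro sum.cong refl) auto
    then show ?thesis
      by (simp add: sum.atLeastLessThan_shift_0[of _ "a * n"] lessThan_atLeast0 add.commute)
  qed
  ultimately show ?thesis by simp
qed

lemma div_mod_less_mult:
  assumes "i < m * n"
  shows "i div n < m" "i mod n < (n::nat)"
proof -
  show "i div n < m" using assms by (rule less_mult_imp_div_less)
  have "0 < n" using assms by (cases n) auto
  then show "i mod n < n" by simp
qed

text \<open>Read \<open>x\<close> as an \<open>m\<close> by \<open>n\<close> array \<open>v\<close>.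
  Contracting \<open>g\<close> with \<open>v\<close> in the second index leaves a kernel
  \<open>H\<close> in the first, and the form of the product kernel is the pairing of
  \<open>f\<close> with \<open>H\<close>. The kernel \<open>H\<close> is positive because its form
  at \<open>y\<close> is the form of \<open>g\<close> at the combination of the rows of
  \<open>v\<close> with coefficients \<open>cnj (y c)\<close>.\<close>

lemma psd_kernel_kron:
  assumes f: "psd_kernel m f" and g: "psd_kernel n g"
  shows "psd_kernel (m * n) (\<lambda>i j. f (i div n) (j div n) * g (i mod n) (j mod n))"
  unfolding psd_kernel_def
proof (intro conjI allI impI)
  show "f (j div n) (i div n) * g (j mod n) (i mod n)
      = cnj (f (i div n) (j div n) * g (i mod n) (j mod n))" if "i < m * n" "j < m * n" for i j
  proof -
    have "i div n < m" "i mod n < n" "j div n < m" "j mod n < n"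
      using that div_mod_less_mult by blast+
    then show ?thesis
      by (simp add: psd_kernel_herm[OF f, of "i div n" "j div n"] psd_kernel_herm[OF g, of "i mod n" "j mod n"])
  qed
  fix x :: "nat \<Rightarrow> complex"
  define v where "v a b = x (a * n + b)" for a b
  have v: "x k = v (k div n) (k mod n)" for k
    by (simp add: v_def)
  \<comment> \<open>The arguments are in the order \<open>c a\<close> because the pairing lemma
    multiplies \<open>f a c\<close> by the transposed entry of the second kernel.\<close>
  define H where "H c a = (\<Sum>b<n. \<Sum>e<n. g b e * v c e * cnj (v a b))" for c a :: nat
  have "psd_kernel m H"
    unfolding psd_kernel_def
  proof (intro conjI allI impI)
    show "H a c = cnj (H c a)" for a c
    proof -
      have "cnj (H c a) = (\<Sum>b<n. \<Sum>e<n. g e b * cnj (v c e) * v a b)"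
        unfolding H_def cnj_sum
      proof (intro sum.cong refl)
        show "cnj (g b e * v c e * cnj (v a b)) = g e b * cnj (v c e) * v a b"
          if "b \<in> {..<n}" "e \<in> {..<n}" for b e
          using psd_kernel_herm[OF g, of b e] that by simp
      qed
      also have "\<dots> = H a c"
        unfolding H_def by (subst sum.swap) (simp add: mult_ac)
      finally show ?thesis ..
    qed
    fix y
    have "qform m H y = (\<Sum>c<m. \<Sum>a<m. \<Sum>b<n. \<Sum>e<n. g b e * (cnj (y c) * v c e) * (y a * cnj (v a b)))"
      by (simp add: qform_def H_def sum_distrib_left sum_distrib_right mult_ac)
    also have "\<dots> = (\<Sum>c<m. \<Sum>b<n. \<Sum>a<m. \<Sum>e<n. g b e * (cnj (y c) * v c e) * (y a * cnj (v a b)))"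
      by (intro sum.cong refl sum.swap)
    also have "\<dots> = (\<Sum>c<m. \<Sum>b<n. \<Sum>e<n. \<Sum>a<m. g b e * (cnj (y c) * v c e) * (y a * cnj (v a b)))"
      by (intro sum.cong refl sum.swap)
    also have "\<dots> = (\<Sum>b<n. \<Sum>c<m. \<Sum>e<n. \<Sum>a<m. g b e * (cnj (y c) * v c e) * (y a * cnj (v a b)))"
      by (rule sum.swap)
    also have "\<dots> = (\<Sum>b<n. \<Sum>e<n. \<Sum>c<m. \<Sum>a<m. g b e * (cnj (y c) * v c e) * (y a * cnj (v a b)))"
      by (intro sum.cong refl sum.swap)
    also have "\<dots> = qform n g (\<lambda>b. \<Sum>c<m. cnj (y c) * v c b)"
      by (simp add: qform_def sum_distrib_left sum_distrib_right mult_ac sum_product)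
    finally show "0 \<le> qform m H y"
      using qform_nonneg[OF g] by simp
  qed
  then have "0 \<le> (\<Sum>a<m. \<Sum>c<m. f a c * H c a)"
    by (rule psd_kernel_pairing_nonneg[OF f])
  also have "\<dots> = (\<Sum>a<m. \<Sum>c<m. \<Sum>b<n. \<Sum>e<n. f a c * g b e * v c e * cnj (v a b))"
    by (simp add: H_def sum_distrib_left mult_ac)
  also have "\<dots> = (\<Sum>a<m. \<Sum>b<n. \<Sum>c<m. \<Sum>e<n. f a c * g b e * v c e * cnj (v a b))"
    by (intro sum.cong refl sum.swap)
  also have "\<dots> = qform (m * n) (\<lambda>i j. f (i div n) (j div n) * g (i mod n) (j mod n)) x"
    unfolding qform_def v
    by (subst sum_div_mod[symmetric], subst sum_div_mod[symmetric]) simp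
  finally show "0 \<le> qform (m * n) (\<lambda>i j. f (i div n) (j div n) * g (i mod n) (j mod n)) x" .
qed

section \<open>Matrices\<close>

lemma index_mult_mat_sum:
  "i < dim_row A \<Longrightarrow> j < dim_col B \<Longrightarrow> dim_col A = dim_row B \<Longrightarrow>
    (A * B) $$ (i, j) = (\<Sum>k<dim_row B. A $$ (i, k) * B $$ (k, j))"
  by (simp add: scalar_prod_def lessThan_atLeast0)

lemma mat_adjoint_adjoint [simp]: "mat_adjoint (mat_adjoint A) = (A :: complex mat)"
  by (intro eq_matI) auto

lemma mat_adjoint_one [simp]: "mat_adjoint (1\<^sub>m d) = (1\<^sub>m d :: complex mat)"
  by (intro eq_matI) auto

lemma mat_adjoint_mult:
  fixes A B :: "complex mat"
  assumes "dim_col A = dim_row B"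
  shows "mat_adjoint (A * B) = mat_adjoint B * mat_adjoint A"
proof (intro eq_matI)
  fix i j assume "i < dim_row (mat_adjoint B * mat_adjoint A)" "j < dim_col (mat_adjoint B * mat_adjoint A)"
  then have ij: "i < dim_col B" "j < dim_row A" by auto
  then show "mat_adjoint (A * B) $$ (i, j) = (mat_adjoint B * mat_adjoint A) $$ (i, j)"
    using assms by (simp add: index_mult_mat_sum mult.commute del: index_mult_mat(1))
qed auto

lemma mtrace_mult:
  assumes "A \<in> carrier_mat r c" "B \<in> carrier_mat c r"
  shows "mtrace (A * B) = (\<Sum>i<r. \<Sum>j<c. A $$ (i, j) * B $$ (j, i))"
proof -
  have "mtrace (A * B) = (\<Sum>i<r. (A * B) $$ (i, i))"
    using assms by (simp add: mtrace_def)
  also have "\<dots> = (\<Sum>i<r. \<Sum>j<c. A $$ (i, j) * B $$ (j, i))"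
    using assms by (intro sum.cong refl) (auto simp: index_mult_mat_sum simp del: index_mult_mat(1))
  finally show ?thesis .
qed

lemma mtrace_mult_commute:
  assumes "A \<in> carrier_mat r c" "B \<in> carrier_mat c r"
  shows "mtrace (A * B) = mtrace (B * A)"
  unfolding mtrace_mult[OF assms] mtrace_mult[OF assms(2,1)]
  by (subst sum.swap) (simp add: mult.commute)

lemma mtrace_minus:
  "A \<in> carrier_mat d d \<Longrightarrow> B \<in> carrier_mat d d \<Longrightarrow> mtrace (A - B) = mtrace A - mtrace B"
  by (auto simp: mtrace_def sum_subtractf[symmetric] intro!: sum.cong)

lemma mtrace_smult: "A \<in> carrier_mat d d \<Longrightarrow> mtrace (c \<cdot>\<^sub>m A) = c * mtrace A"
  by (auto simp: mtrace_def sum_distrib_left intro!: sum.cong)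

lemma msum_carrier [simp, intro]: "msum r c I A \<in> carrier_mat r c"
  by (simp add: msum_def)

lemma mtrace_mult_msum:
  assumes "W \<in> carrier_mat d d" "\<And>i. i \<in> I \<Longrightarrow> A i \<in> carrier_mat d d"
  shows "mtrace (W * msum d d I A) = (\<Sum>i\<in>I. mtrace (W * A i))"
proof -
  have "mtrace (W * msum d d I A) = (\<Sum>a<d. \<Sum>b<d. \<Sum>i\<in>I. W $$ (a, b) * A i $$ (b, a))"
    using assms(1) by (auto simp: mtrace_mult[of _ d d] msum_def sum_distrib_left intro!: sum.cong)
  also have "\<dots> = (\<Sum>a<d. \<Sum>i\<in>I. \<Sum>b<d. W $$ (a, b) * A i $$ (b, a))"
    by (intro sum.cong refl sum.swap)
  also have "\<dots> = (\<Sum>i\<in>I. \<Sum>a<d. \<Sum>b<d. W $$ (a, b) * A i $$ (b, a))"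
    by (rule sum.swap)
  also have "\<dots> = (\<Sum>i\<in>I. mtrace (W * A i))"
    using assms by (intro sum.cong refl) (simp add: mtrace_mult[of _ d d])
  finally show ?thesis .
qed

section \<open>Positive-semidefinite matrices\<close>

lemma psd_carrier: "psd d A \<Longrightarrow> A \<in> carrier_mat d d"
  by (simp add: psd_iff_psd_kernel)

lemma psd_kernelI: "psd d A \<Longrightarrow> psd_kernel d (\<lambda>i j. A $$ (i, j))"
  by (simp add: psd_iff_psd_kernel)

lemma mtrace_psd_mult_nonneg:
  assumes "psd d A" "psd d B"
  shows "0 \<le> mtrace (A * B)"
  using psd_kernel_pairing_nonneg[OF assms[THEN psd_kernelI]] assms[THEN psd_carrier]
  by (simp add: mtrace_mult[of _ d d])

lemma mtrace_psd_nonneg: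
  assumes "psd d A"
  shows "0 \<le> mtrace A"
  using psd_kernel_diag_nonneg[OF psd_kernelI[OF assms]] psd_carrier[OF assms]
  by (auto simp: mtrace_def intro!: sum_nonneg)

text \<open>Nonnegative diagonal entries with sum zero all vanish, and a vanishing diagonal entry
  annihilates its row.\<close>

lemma psd_mtrace_zero:
  assumes "psd d A" "mtrace A = 0"
  shows "A = 0\<^sub>m d d"
proof -
  note A = psd_kernelI[OF assms(1)] and c = psd_carrier[OF assms(1)]
  have "(\<Sum>i<d. A $$ (i, i)) = 0"
    using assms(2) c by (simp add: mtrace_def)
  then have "A $$ (i, i) = 0" if "i < d" for i
    using sum_nonneg_eq_0_iff[of "{..<d}" "\<lambda>i. A $$ (i, i)"] psd_kernel_diag_nonneg[OF A] that by simp
  then have "A $$ (i, j) = 0" if "i < d" "j < d" for i j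
    using psd_kernel_zero_diag[OF A that] that by blast
  with c show ?thesis by (intro eq_matI) auto
qed

lemma psd_smult:
  assumes "psd d A" "0 \<le> c"
  shows "psd d (c \<cdot>\<^sub>m A)"
  unfolding psd_iff_psd_kernel psd_kernel_def
proof (intro conjI allI impI)
  note A = psd_kernelI[OF assms(1)] and carr = psd_carrier[OF assms(1)]
  show "c \<cdot>\<^sub>m A \<in> carrier_mat d d" using carr by simp
  have c: "cnj c = c" using assms(2) by (simp add: less_eq_complex_def complex_eq_iff)
  show "(c \<cdot>\<^sub>m A) $$ (j, i) = cnj ((c \<cdot>\<^sub>m A) $$ (i, j))" if "i < d" "j < d" for i j
    using psd_kernel_herm[OF A that] that carr c by simp
  show "0 \<le> qform d (\<lambda>i j. (c \<cdot>\<^sub>m A) $$ (i, j)) x" for x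
  proof -
    have "qform d (\<lambda>i j. (c \<cdot>\<^sub>m A) $$ (i, j)) x = c * qform d (\<lambda>i j. A $$ (i, j)) x"
      using carr by (auto simp: qform_def sum_distrib_left mult_ac intro!: sum.cong)
    also have "0 \<le> \<dots>" using assms(2) qform_nonneg[OF A] by (rule mult_nonneg_nonneg)
    finally show ?thesis .
  qed
qed

lemma qform_diagonal:
  "qform d (\<lambda>i j. if i = j then a else 0) x = a * of_real (\<Sum>i<d. (cmod (x i))\<^sup>2)"
proof -
  have "qform d (\<lambda>i j. if i = j then a else 0) x = (\<Sum>i<d. \<Sum>j<d. if i = j then a * (x j * cnj (x i)) else 0)"
    unfolding qform_def by (intro sum.cong refl) (auto simp: mult_ac)
  also have "\<dots> = a * of_real (\<Sum>i<d. (cmod (x i))\<^sup>2)"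
    by (simp add: complex_norm_square[symmetric] sum_distrib_left del: of_real_power)
  finally show ?thesis .
qed

lemma psd_one [simp]: "psd d (1\<^sub>m d)"
  unfolding psd_iff_psd_kernel psd_kernel_def
proof (intro conjI allI impI)
  fix x
  have "qform d (\<lambda>i j. 1\<^sub>m d $$ (i, j)) x = qform d (\<lambda>i j. if i = j then 1 else 0) x"
    by (auto simp: qform_def intro!: sum.cong)
  also have "0 \<le> \<dots>"
    unfolding qform_diagonal by (simp add: less_eq_complex_def sum_nonneg)
  finally show "0 \<le> qform d (\<lambda>i j. 1\<^sub>m d $$ (i, j)) x" .
qed auto

lemma psd_zero [simp]: "psd d (0\<^sub>m d d)"
  by (auto simp: psd_iff_psd_kernel psd_kernel_def qform_def)

lemma inner_mat_adjoint:
  fixes K :: "complex mat"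
  assumes "K \<in> carrier_mat e d" "v \<in> carrier_vec d" "w \<in> carrier_vec e"
  shows "(mat_adjoint K *\<^sub>v w) \<bullet>c v = w \<bullet>c (K *\<^sub>v v)"
proof -
  have "(mat_adjoint K *\<^sub>v w) \<bullet>c v = (\<Sum>i<d. \<Sum>a<e. w $ a * (cnj (K $$ (a, i)) * cnj (v $ i)))"
    using assms by (auto simp: scalar_prod_def lessThan_atLeast0 sum_distrib_left sum_distrib_right mult_ac intro!: sum.cong)
  also have "\<dots> = (\<Sum>a<e. \<Sum>i<d. w $ a * (cnj (K $$ (a, i)) * cnj (v $ i)))"
    by (rule sum.swap)
  also have "\<dots> = w \<bullet>c (K *\<^sub>v v)"
    using assms by (auto simp: scalar_prod_def lessThan_atLeast0 sum_distrib_left intro!: sum.cong)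
  finally show ?thesis .
qed

text \<open>The form at \<open>v\<close> is the form of \<open>A\<close> at \<open>K v\<close>. The
  matrix \<open>K\<close> may be rectangular, since a Kraus operator can change the local
  dimension.\<close>

lemma psd_conjugation:
  assumes A: "psd e A" and K: "K \<in> carrier_mat e d"
  shows "psd d (mat_adjoint K * A * K)"
  unfolding psd_def hermitian_def
proof (intro conjI ballI)
  have c: "A \<in> carrier_mat e e" and h: "mat_adjoint A = A"
    using A by (auto simp: psd_def hermitian_def)
  have K': "mat_adjoint K \<in> carrier_mat d e" using K by simp
  have K'A: "mat_adjoint K * A \<in> carrier_mat d e" using K' c by simp
  then show "mat_adjoint K * A * K \<in> carrier_mat d d" using K by simp
  have "mat_adjoint (mat_adjoint K * A * K) = mat_adjoint K * (A * K)"
    using K K' c K'A by (simp add: mat_adjoint_mult h del: assoc_mult_mat)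
  also have "\<dots> = mat_adjoint K * A * K"
    by (rule assoc_mult_mat[OF K' c K, symmetric])
  finally show "mat_adjoint (mat_adjoint K * A * K) = mat_adjoint K * A * K" .
  fix v :: "complex vec" assume v: "v \<in> carrier_vec d"
  have "((mat_adjoint K * A * K) *\<^sub>v v) = mat_adjoint K *\<^sub>v (A *\<^sub>v (K *\<^sub>v v))"
    using assoc_mult_mat_vec[OF K'A K v] assoc_mult_mat_vec[OF K' c, of "K *\<^sub>v v"] K v by simp
  also have "\<dots> \<bullet>c v = (A *\<^sub>v (K *\<^sub>v v)) \<bullet>c (K *\<^sub>v v)"
    using K v c by (intro inner_mat_adjoint) auto
  also have "0 \<le> \<dots>"
    using A K v by (auto simp: psd_def)
  finally show "0 \<le> ((mat_adjoint K * A * K) *\<^sub>v v) \<bullet>c v" .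
qed

text \<open>Makes a multiple of \<open>A\<close> admissible as a measurement operator. The sum of
  the moduli of the entries bounds the form relative to the squared norm, a crude substitute for the
  largest eigenvalue.\<close>

lemma psd_one_minus_smult:
  assumes A: "psd d A"
  obtains c :: real where "0 < c" "psd d (1\<^sub>m d - complex_of_real c \<cdot>\<^sub>m A)"
proof
  note K = psd_kernelI[OF A] and carr = psd_carrier[OF A]
  \<comment> \<open>The summand 1 keeps \<open>C\<close> positive even for
    \<open>A = 0\<close>.\<close>
  define C where "C = (\<Sum>i<d. \<Sum>j<d. cmod (A $$ (i, j))) + 1"
  have C: "0 < C" unfolding C_def by (intro add_nonneg_pos sum_nonneg) auto
  then show "0 < 1 / C" by simp
  let ?B = "1\<^sub>m d - complex_of_real (1 / C) \<cdot>\<^sub>m A"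
  show "psd d ?B"
    unfolding psd_iff_psd_kernel psd_kernel_def
  proof (intro conjI allI impI)
    show "?B \<in> carrier_mat d d" using carr by (intro minus_carrier_mat smult_carrier_mat)
    show "?B $$ (j, i) = cnj (?B $$ (i, j))" if "i < d" "j < d" for i j
      using carr that psd_kernel_herm[OF K that] by auto
    fix x
    define N where "N = (\<Sum>i<d. (cmod (x i))\<^sup>2)"
    have "N \<ge> 0" by (simp add: N_def sum_nonneg)
    have x: "cmod (x i) \<le> sqrt N" if "i < d" for i
      unfolding N_def by (rule real_le_rsqrt) (use that in \<open>auto intro!: member_le_sum\<close>)
    have "cmod (qform d (\<lambda>i j. A $$ (i, j)) x) \<le> (\<Sum>i<d. \<Sum>j<d. cmod (A $$ (i, j)) * N)"
      unfolding qform_def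
    proof (intro order_trans[OF norm_sum] sum_mono)
      fix i j assume ij: "i \<in> {..<d}" "j \<in> {..<d}"
      have "cmod (x j) * cmod (x i) \<le> sqrt N * sqrt N"
        using ij x \<open>N \<ge> 0\<close> by (intro mult_mono) auto
      also have "\<dots> = N" using \<open>N \<ge> 0\<close> by simp
      finally show "cmod (A $$ (i, j) * x j * cnj (x i)) \<le> cmod (A $$ (i, j)) * N"
        by (simp add: norm_mult mult.assoc mult_left_mono)
    qed
    also have "\<dots> \<le> C * N"
      using \<open>N \<ge> 0\<close> by (simp add: C_def sum_distrib_right[symmetric] distrib_right)
    finally have "Re (qform d (\<lambda>i j. A $$ (i, j)) x) \<le> C * N"
      using complex_Re_le_cmod order_trans by blast
    then have le: "Re (qform d (\<lambda>i j. A $$ (i, j)) x) / C \<le> N"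
      using C by (simp add: field_simps)
    have "qform d (\<lambda>i j. ?B $$ (i, j)) x
        = qform d (\<lambda>i j. if i = j then 1 else 0) x - of_real (1 / C) * qform d (\<lambda>i j. A $$ (i, j)) x"
      unfolding qform_def sum_distrib_left sum_subtractf[symmetric]
      using carr by (intro sum.cong refl) (auto simp: algebra_simps)
    also have "\<dots> = of_real N - of_real (1 / C) * qform d (\<lambda>i j. A $$ (i, j)) x"
      by (simp add: qform_diagonal N_def)
    also have "0 \<le> \<dots>"
      using le qform_nonneg[OF K, of x] C by (simp add: less_eq_complex_def)
    finally show "0 \<le> qform d (\<lambda>i j. ?B $$ (i, j)) x" .
  qed
qed

text \<open>For a Hermitian matrix, the trace of the square is the squared Frobenius norm.\<close>

lemma hermitian_mtrace_square_zero:
  assumes A: "hermitian d A" and "mtrace (A * A) = 0"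
  shows "A = 0\<^sub>m d d"
proof -
  have carr: "A \<in> carrier_mat d d" and h: "\<And>i j. i < d \<Longrightarrow> j < d \<Longrightarrow> A $$ (j, i) = cnj (A $$ (i, j))"
    using A unfolding hermitian_iff by blast+
  have "mtrace (A * A) = (\<Sum>i<d. \<Sum>j<d. of_real ((cmod (A $$ (i, j)))\<^sup>2))"
    unfolding mtrace_mult[OF carr carr] complex_norm_square
    by (intro sum.cong refl) (metis h lessThan_iff)
  then have "(\<Sum>i<d. \<Sum>j<d. (cmod (A $$ (i, j)))\<^sup>2) = 0"
    using assms(2) by (simp flip: of_real_sum of_real_power)
  then have "A $$ (i, j) = 0" if "i < d" "j < d" for i j
    using that by (simp add: sum_nonneg_eq_0_iff sum_nonneg)
  with carr show ?thesis by (intro eq_matI) auto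
qed

section \<open>Kronecker products\<close>

lemma dim_kron [simp]:
  "dim_row (kron A B) = dim_row A * dim_row B" "dim_col (kron A B) = dim_col A * dim_col B"
  by (simp_all add: kron_def)

lemma index_kron:
  "i < dim_row A * dim_row B \<Longrightarrow> j < dim_col A * dim_col B \<Longrightarrow>
    kron A B $$ (i, j) =
      A $$ (i div dim_row B, j div dim_col B) * B $$ (i mod dim_row B, j mod dim_col B)"
  by (simp add: kron_def)

lemma kron_mult:
  assumes AC: "dim_col A = dim_row C" and BD: "dim_col B = dim_row D"
  shows "kron A B * kron C D = kron (A * C) (B * D)"
proof (intro eq_matI)
  fix i j assume "i < dim_row (kron (A * C) (B * D))" "j < dim_col (kron (A * C) (B * D))"
  then have i: "i < dim_row A * dim_row B" and j: "j < dim_col C * dim_col D" by simp_all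
  note bounds = div_mod_less_mult[OF i] div_mod_less_mult[OF j]
  have "(kron A B * kron C D) $$ (i, j) = (\<Sum>k<dim_row C * dim_row D. kron A B $$ (i, k) * kron C D $$ (k, j))"
    using i j AC BD by (simp add: index_mult_mat_sum del: index_mult_mat(1))
  also have "\<dots> = (\<Sum>k<dim_row C * dim_row D.
      (\<lambda>a b. (A $$ (i div dim_row B, a) * B $$ (i mod dim_row B, b)) *
        (C $$ (a, j div dim_col D) * D $$ (b, j mod dim_col D))) (k div dim_row D) (k mod dim_row D))"
    using i j AC BD by (intro sum.cong refl) (simp add: index_kron)
  also have "\<dots> = (\<Sum>a<dim_row C. \<Sum>b<dim_row D.
      (A $$ (i div dim_row B, a) * B $$ (i mod dim_row B, b)) *
        (C $$ (a, j div dim_col D) * D $$ (b, j mod dim_col D)))"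
    by (rule sum_div_mod)
  also have "\<dots> = (\<Sum>a<dim_row C. A $$ (i div dim_row B, a) * C $$ (a, j div dim_col D)) *
      (\<Sum>b<dim_row D. B $$ (i mod dim_row B, b) * D $$ (b, j mod dim_col D))"
    by (simp add: sum_product mult_ac)
  also have "\<dots> = kron (A * C) (B * D) $$ (i, j)"
    using i j bounds AC BD by (simp add: index_kron index_mult_mat_sum del: index_mult_mat(1))
  finally show "(kron A B * kron C D) $$ (i, j) = kron (A * C) (B * D) $$ (i, j)" .
qed auto

lemma mat_adjoint_kron: "mat_adjoint (kron A B) = kron (mat_adjoint A) (mat_adjoint B)"
proof (intro eq_matI)
  fix i j assume "i < dim_row (kron (mat_adjoint A) (mat_adjoint B))" "j < dim_col (kron (mat_adjoint A) (mat_adjoint B))"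
  then have i: "i < dim_col A * dim_col B" and j: "j < dim_row A * dim_row B" by simp_all
  show "mat_adjoint (kron A B) $$ (i, j) = kron (mat_adjoint A) (mat_adjoint B) $$ (i, j)"
    using i j div_mod_less_mult[OF i] div_mod_less_mult[OF j] by (simp add: index_kron)
qed auto

lemma kron_one: "kron (1\<^sub>m m) (1\<^sub>m n) = 1\<^sub>m (m * n)"
proof (intro eq_matI)
  fix i j assume "i < dim_row (1\<^sub>m (m * n) :: complex mat)" "j < dim_col (1\<^sub>m (m * n) :: complex mat)"
  then have i: "i < m * n" and j: "j < m * n" by simp_all
  have "i = j" if "i div n = j div n" "i mod n = j mod n"
    using that by (metis div_mult_mod_eq)
  then show "kron (1\<^sub>m m) (1\<^sub>m n) $$ (i, j) = 1\<^sub>m (m * n) $$ (i, j)"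
    using i j div_mod_less_mult[OF i] div_mod_less_mult[OF j] by (auto simp: index_kron)
qed auto

lemma kron_smult: "kron (a \<cdot>\<^sub>m A) (b \<cdot>\<^sub>m B) = (a * b) \<cdot>\<^sub>m kron A B"
proof (intro eq_matI)
  fix i j assume "i < dim_row ((a * b) \<cdot>\<^sub>m kron A B)" "j < dim_col ((a * b) \<cdot>\<^sub>m kron A B)"
  then have i: "i < dim_row A * dim_row B" and j: "j < dim_col A * dim_col B" by simp_all
  show "kron (a \<cdot>\<^sub>m A) (b \<cdot>\<^sub>m B) $$ (i, j) = ((a * b) \<cdot>\<^sub>m kron A B) $$ (i, j)"
    using i j div_mod_less_mult[OF i] div_mod_less_mult[OF j] by (simp add: index_kron)
qed auto

lemma psd_kron:
  assumes "psd m A" "psd n B"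
  shows "psd (m * n) (kron A B)"
proof -
  note c = psd_carrier[OF assms(1)] psd_carrier[OF assms(2)]
  have idx: "kron A B $$ (i, j) = A $$ (i div n, j div n) * B $$ (i mod n, j mod n)"
    if "i < m * n" "j < m * n" for i j
    using that c by (subst index_kron) auto
  have k: "psd_kernel (m * n) (\<lambda>i j. A $$ (i div n, j div n) * B $$ (i mod n, j mod n))"
    using psd_kernel_kron[OF assms[THEN psd_kernelI]] .
  have "qform (m * n) (\<lambda>i j. kron A B $$ (i, j)) x
      = qform (m * n) (\<lambda>i j. A $$ (i div n, j div n) * B $$ (i mod n, j mod n)) x" for x
    by (auto simp: qform_def idx intro!: sum.cong)
  moreover have "kron A B $$ (j, i) = cnj (kron A B $$ (i, j))" if "i < m * n" "j < m * n" for i j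
    unfolding idx[OF that] idx[OF that(2,1)] using psd_kernel_herm[OF k that] .
  moreover have "kron A B \<in> carrier_mat (m * n) (m * n)"
    using c by (intro carrier_matI) auto
  ultimately show ?thesis
    using qform_nonneg[OF k] unfolding psd_iff_psd_kernel psd_kernel_def by metis
qed

lemma kron_list_Nil [simp]: "kron_list [] = 1\<^sub>m 1"
  and kron_list_Cons [simp]: "kron_list (A # As) = kron A (kron_list As)"
  by (simp_all add: kron_list_def)

lemma dim_kron_list [simp]:
  "dim_row (kron_list As) = prod_list (map dim_row As)"
  "dim_col (kron_list As) = prod_list (map dim_col As)"
  by (induction As) auto

lemma kron_list_mult:
  assumes "list_all2 (\<lambda>A B. dim_col A = dim_row B) As Bs"
  shows "kron_list As * kron_list Bs = kron_list (map2 (*) As Bs)"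
  using assms
proof (induction rule: list_all2_induct)
  case (Cons A As B Bs)
  have "map dim_col As = map dim_row Bs"
    using Cons.hyps(2) by (induction rule: list_all2_induct) auto
  then show ?case using Cons by (simp add: kron_mult)
qed simp

lemma mat_adjoint_kron_list: "mat_adjoint (kron_list As) = kron_list (map mat_adjoint As)"
  by (induction As) (auto simp: mat_adjoint_kron)

lemma kron_list_one: "kron_list (map 1\<^sub>m ds) = 1\<^sub>m (prod_list ds)"
  by (induction ds) (auto simp: kron_one)

lemma kron_list_smult:
  "kron_list (map (\<lambda>k. c k \<cdot>\<^sub>m A k) ks) = prod_list (map c ks) \<cdot>\<^sub>m kron_list (map A ks)"
  by (induction ks) (auto simp: kron_smult)

lemma psd_kron_list: "list_all2 psd ds As \<Longrightarrow> psd (prod_list ds) (kron_list As)"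
  by (induction rule: list_all2_induct) (auto intro: psd_kron)

lemma local_op_carrier:
  assumes "k < length ds" "K \<in> carrier_mat e (ds ! k)"
  shows "local_op ds k K \<in> carrier_mat (hdim (ds[k := e])) (hdim ds)"
proof -
  have "map dim_row ((map 1\<^sub>m ds)[k := K]) = ds[k := e]"
    "map dim_col ((map 1\<^sub>m ds)[k := K]) = ds"
    using assms by (auto intro!: nth_equalityI simp: nth_list_update)
  then show ?thesis by (intro carrier_matI) (simp_all add: local_op_def)
qed

text \<open>By the mixed-product rule the conjugation acts factor by factor, and the parties other
  than \<open>k\<close> carry identities. The factors \<open>As\<close> live on the dimensions after
  the instrument, the result on those before it.\<close>

lemma local_op_conjugation:
  assumes k: "k < length ds" and K: "K \<in> carrier_mat e (ds ! k)"
    and As: "list_all2 (\<lambda>d A. A \<in> carrier_mat d d) (ds[k := e]) As"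
  shows "mat_adjoint (local_op ds k K) * kron_list As * local_op ds k K
    = kron_list (As[k := mat_adjoint K * As ! k * K])"
proof -
  have len: "length As = length ds"
    using As by (auto dest: list_all2_lengthD)
  have A: "As ! j \<in> carrier_mat (ds[k := e] ! j) (ds[k := e] ! j)" if "j < length ds" for j
    using As that len by (auto simp: list_all2_conv_all_nth)
  let ?L = "(map 1\<^sub>m ds)[k := K]"
  let ?M = "map2 (*) (map mat_adjoint ?L) As"
  have dimA: "dim_row (As ! j) = (if j = k then e else ds ! j)" "dim_col (As ! j) = (if j = k then e else ds ! j)"
    if "j < length ds" for j
    using A[OF that] k by auto
  have L: "?L ! j = (if j = k then K else 1\<^sub>m (ds ! j))" if "j < length ds" for j
    using that by (simp add: nth_list_update)
  have 1: "kron_list (map mat_adjoint ?L) * kron_list As = kron_list ?M"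
  proof (intro kron_list_mult list_all2_all_nthI)
    fix j assume "j < length (map mat_adjoint ?L)"
    then show "dim_col (map mat_adjoint ?L ! j) = dim_row (As ! j)"
      using K by (simp add: L dimA del: map_update)
  qed (use len in simp)
  have 2: "kron_list ?M * kron_list ?L = kron_list (map2 (*) ?M ?L)"
  proof (intro kron_list_mult list_all2_all_nthI)
    fix j assume "j < length ?M"
    then show "dim_col (?M ! j) = dim_row (?L ! j)"
      using K len by (simp add: L dimA del: map_update)
  qed (use len in simp)
  have "map2 (*) ?M ?L = As[k := mat_adjoint K * As ! k * K]"
  proof (rule nth_equalityI)
    fix j assume "j < length (map2 (*) ?M ?L)"
    then have j: "j < length ds" using len by simp
    show "map2 (*) ?M ?L ! j = As[k := mat_adjoint K * As ! k * K] ! j"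
      using A[OF j] j len by (simp add: L nth_list_update del: map_update)
  qed (use len in simp)
  with 1 2 show ?thesis
    by (simp add: local_op_def mat_adjoint_kron_list)
qed

section \<open>Separable operators\<close>

lemma psd_eq_smult_state:
  assumes A: "psd d A" and "0 < d"
  obtains c :: real and \<sigma> where "0 \<le> c" "state d \<sigma>" "A = complex_of_real c \<cdot>\<^sub>m \<sigma>"
proof (cases "mtrace A = 0")
  case True
  \<comment> \<open>A zero operator determines no state, so the maximally mixed one is taken with
    coefficient 0; it exists because \<open>d\<close> is positive.\<close>
  have "state d ((1 / of_nat d) \<cdot>\<^sub>m 1\<^sub>m d)"
    using \<open>0 < d\<close> by (auto simp: state_def mtrace_def less_eq_complex_def intro!: psd_smult)
  moreover have "A = complex_of_real 0 \<cdot>\<^sub>m ((1 / of_nat d) \<cdot>\<^sub>m 1\<^sub>m d)"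
    using psd_mtrace_zero[OF A True] by (auto intro!: eq_matI)
  ultimately show thesis using that[of 0] by blast
next
  case False
  define t where "t = Re (mtrace A)"
  have t: "mtrace A = of_real t" "0 \<le> t"
    using mtrace_psd_nonneg[OF A] by (auto simp: t_def less_eq_complex_def complex_eq_iff)
  have carr: "A \<in> carrier_mat d d" using A by (rule psd_carrier)
  have "state d ((1 / of_real t) \<cdot>\<^sub>m A)"
    using A t False by (auto simp: state_def mtrace_smult[OF carr] less_eq_complex_def intro!: psd_smult)
  moreover have "A = complex_of_real t \<cdot>\<^sub>m ((1 / of_real t) \<cdot>\<^sub>m A)"
    using t False by (auto intro!: eq_matI)
  ultimately show thesis using that t(2) by blast
qed

text \<open>\<open>SEP\<close> asks for normalised local states. Normalising every factor collects
  the scalars in one coefficient \<open>p\<close>, so a sum of length 1 is a separable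
  decomposition.\<close>

lemma kron_list_psd_in_SEP:
  assumes "\<forall>d\<in>set ds. 0 < d" and As: "list_all2 psd ds As"
  shows "kron_list As \<in> SEP ds"
proof -
  have "\<exists>c \<sigma>. 0 \<le> c \<and> state (ds ! k) \<sigma> \<and> As ! k = complex_of_real c \<cdot>\<^sub>m \<sigma>" if "k < length ds" for k
    using that assms psd_eq_smult_state[of "ds ! k" "As ! k"] unfolding list_all2_conv_all_nth
    by (metis nth_mem)
  then obtain c \<sigma> where c\<sigma>:
    "\<And>k. k < length ds \<Longrightarrow> 0 \<le> c k \<and> state (ds ! k) (\<sigma> k) \<and> As ! k = complex_of_real (c k) \<cdot>\<^sub>m \<sigma> k"
    by metis
  define p where "p = prod_list (map c [0..<length ds])"
  let ?K = "kron_list (map \<sigma> [0..<length ds])"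
  have "0 \<le> p"
    unfolding p_def using c\<sigma> by (intro prod_list_nonneg) auto
  have "list_all2 psd ds (map \<sigma> [0..<length ds])"
    using c\<sigma> by (auto simp: list_all2_conv_all_nth state_def)
  from psd_kron_list[OF this] have K: "?K \<in> carrier_mat (hdim ds) (hdim ds)"
    by (rule psd_carrier)
  have "As = map (\<lambda>k. complex_of_real (c k) \<cdot>\<^sub>m \<sigma> k) [0..<length ds]"
    using c\<sigma> list_all2_lengthD[OF As] by (intro nth_equalityI) auto
  then have "kron_list As = prod_list (map (\<lambda>k. complex_of_real (c k)) [0..<length ds]) \<cdot>\<^sub>m ?K"
    by (simp only: kron_list_smult)
  also have "prod_list (map (\<lambda>k. complex_of_real (c k)) ks) = of_real (prod_list (map c ks))" for ks
    by (induction ks) auto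
  finally have eq: "kron_list As = complex_of_real p \<cdot>\<^sub>m ?K"
    unfolding p_def .
  also have "\<dots> = msum (hdim ds) (hdim ds) {..<1::nat}
      (\<lambda>l. complex_of_real p \<cdot>\<^sub>m kron_list (map \<sigma> [0..<length ds]))"
    using K by (auto simp: msum_def intro!: eq_matI)
  finally show ?thesis
    unfolding SEP_def using psd_kron_list[OF As] \<open>0 \<le> p\<close> c\<sigma>
    by (intro CollectI conjI exI[of _ "1::nat"] exI[of _ "\<lambda>_. p"] exI[of _ "\<lambda>_. \<sigma>"]) auto
qed

lemma list_all2_psd_one: "list_all2 psd ds (map 1\<^sub>m ds)"
  by (simp add: list_all2_conv_all_nth)

text \<open>The identity is the test operator that forces a witness to have nonnegative trace and
  that bounds the admissible \<open>q\<close> in \<open>Q_bound\<close> from below.\<close>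

lemma one_in_SEP: "\<forall>d\<in>set ds. 0 < d \<Longrightarrow> 1\<^sub>m (hdim ds) \<in> SEP ds"
  using kron_list_psd_in_SEP[OF _ list_all2_psd_one] by (simp add: kron_list_one)

section \<open>LOCC measurement operators\<close>

text \<open>
  The functionals \<open>N \<mapsto> Tr (W N)\<close> that are nonnegative on products of positive operators pull
  back under a local Kraus operator \<open>L\<close> to functionals of the same kind, with \<open>L W L\<^sup>\<dagger>\<close> in place of
  \<open>W\<close>. This dual form of the separability of LOCC operators needs no explicit separable decomposition.
\<close>

lemma realizes_locc_pairing_nonneg:
  assumes "realizes_locc n ds M" and "i \<le> n"
  shows "M i \<in> carrier_mat (hdim ds) (hdim ds) \<and>
    (\<forall>W\<in>carrier_mat (hdim ds) (hdim ds).
      (\<forall>As. list_all2 psd ds As \<longrightarrow> 0 \<le> mtrace (W * kron_list As)) \<longrightarrow> 0 \<le> mtrace (W * M i))"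
  using assms(1)
\<comment> \<open>The quantifier over \<open>W\<close> belongs to the induction statement, since
  each Kraus operator leads to its own transformed \<open>W\<close> on the space of the branch. The
  carrier claim is carried along because cyclicity of the trace needs the dimensions of
  \<open>N x i\<close>.\<close>
proof (induction rule: realizes_locc.induct)
  case (stop c M ds)
  show ?case
  proof (intro conjI ballI impI)
    show "M i \<in> carrier_mat (hdim ds) (hdim ds)" using stop \<open>i \<le> n\<close> by simp
    fix W :: "complex mat"
    assume W: "W \<in> carrier_mat (hdim ds) (hdim ds)"
      and nonneg: "\<forall>As. list_all2 psd ds As \<longrightarrow> 0 \<le> mtrace (W * kron_list As)"
    have "0 \<le> mtrace (W * 1\<^sub>m (hdim ds))"
      using nonneg list_all2_psd_one[of ds] by (metis kron_list_one)
    moreover have "mtrace (W * 0\<^sub>m (hdim ds) (hdim ds)) = 0"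
      using W by (simp add: mtrace_def)
    ultimately show "0 \<le> mtrace (W * M i)" using stop \<open>i \<le> n\<close> by simp
  qed
next
  case (step k ds I N M)
  let ?J = "SIGMA x:{..<length I}. {..<length (snd (I ! x))}"
  let ?L = "\<lambda>x a. local_op ds k (snd (I ! x) ! a)"
  let ?D = "hdim ds" and ?E = "\<lambda>x. hdim (ds[k := fst (I ! x)])"
  have M: "M i = msum ?D ?D ?J (\<lambda>(x, a). mat_adjoint (?L x a) * N x i * ?L x a)"
    using step.hyps \<open>i \<le> n\<close> by blast
  have Kraus: "snd (I ! x) ! a \<in> carrier_mat (fst (I ! x)) (ds ! k)"
    if "x < length I" "a < length (snd (I ! x))" for x a
  proof -
    have "I ! x \<in> set I" "snd (I ! x) ! a \<in> set (snd (I ! x))" using that by simp_all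
    then show ?thesis using step.hyps(2) unfolding instrument_def by fastforce
  qed
  have N: "N x i \<in> carrier_mat (?E x) (?E x)" if "x < length I" for x
    using step.IH that by blast
  have L: "?L x a \<in> carrier_mat (?E x) ?D" if "x < length I" "a < length (snd (I ! x))" for x a
    using local_op_carrier[OF step.hyps(1) Kraus[OF that]] .
  have L': "mat_adjoint (?L x a) \<in> carrier_mat ?D (?E x)" if "x < length I" "a < length (snd (I ! x))" for x a
    using L[OF that] by (rule mat_adjoint_carrier)
  show ?case
  proof (intro conjI ballI impI)
    show "M i \<in> carrier_mat ?D ?D" unfolding M by simp
    fix W :: "complex mat"
    assume W: "W \<in> carrier_mat ?D ?D"
      and nonneg: "\<forall>As. list_all2 psd ds As \<longrightarrow> 0 \<le> mtrace (W * kron_list As)"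
    \<comment> \<open>Cyclicity of the trace moves the Kraus operators onto \<open>W\<close>. The
      identity is stated for general \<open>X\<close> because it serves both for product operators
      and for \<open>N x i\<close>.\<close>
    have cyc: "mtrace (W * (mat_adjoint (?L x a) * X * ?L x a))
        = mtrace ((?L x a * W * mat_adjoint (?L x a)) * X)"
      if xa: "x < length I" "a < length (snd (I ! x))" and X: "X \<in> carrier_mat (?E x) (?E x)" for x a X
    proof -
      note c = W X L[OF xa] L'[OF xa]
      have LX: "mat_adjoint (?L x a) * X \<in> carrier_mat ?D (?E x)"
        by (rule mult_carrier_mat[OF c(4,2)])
      have WLX: "W * (mat_adjoint (?L x a) * X) \<in> carrier_mat ?D (?E x)"
        by (rule mult_carrier_mat[OF W LX])
      have LW: "?L x a * W \<in> carrier_mat (?E x) ?D"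
        by (rule mult_carrier_mat[OF c(3) W])
      have "mtrace (W * (mat_adjoint (?L x a) * X * ?L x a))
          = mtrace ((W * (mat_adjoint (?L x a) * X)) * ?L x a)"
        by (simp only: assoc_mult_mat[OF W LX c(3)])
      also have "\<dots> = mtrace (?L x a * (W * (mat_adjoint (?L x a) * X)))"
        by (rule mtrace_mult_commute[OF WLX c(3)])
      also have "?L x a * (W * (mat_adjoint (?L x a) * X)) = (?L x a * W * mat_adjoint (?L x a)) * X"
        by (simp only: assoc_mult_mat[OF c(3) W LX] assoc_mult_mat[OF LW c(4) X])
      finally show ?thesis .
    qed
    have "0 \<le> mtrace (W * (mat_adjoint (?L x a) * N x i * ?L x a))"
      if xa: "x < length I" "a < length (snd (I ! x))" for x a
    proof -
      \<comment> \<open>This is the premise of the induction hypothesis for the transformed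
        operator: its value on a product is the value of \<open>W\<close> on the product whose
        \<open>k\<close>-th factor is conjugated by the Kraus operator, and that factor stays
        positive.\<close>
      have "0 \<le> mtrace ((?L x a * W * mat_adjoint (?L x a)) * kron_list As)"
        if As: "list_all2 psd (ds[k := fst (I ! x)]) As" for As
      proof -
        let ?As = "As[k := mat_adjoint (snd (I ! x) ! a) * As ! k * (snd (I ! x) ! a)]"
        have "psd (fst (I ! x)) (As ! k)"
          using As step.hyps(1) by (auto simp: list_all2_conv_all_nth)
        then have "psd (ds ! k) (mat_adjoint (snd (I ! x) ! a) * As ! k * (snd (I ! x) ! a))"
          by (rule psd_conjugation[OF _ Kraus[OF xa]])
        then have "list_all2 psd ds ?As"
          using As step.hyps(1) by (auto simp: list_all2_conv_all_nth nth_list_update split: if_splits)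
        with nonneg have "0 \<le> mtrace (W * kron_list ?As)" by blast
        also have "kron_list ?As = mat_adjoint (?L x a) * kron_list As * ?L x a"
          using As by (intro local_op_conjugation[OF step.hyps(1) Kraus[OF xa], symmetric])
            (auto elim: list_all2_mono intro: psd_carrier)
        also have "mtrace (W * \<dots>) = mtrace ((?L x a * W * mat_adjoint (?L x a)) * kron_list As)"
          by (rule cyc[OF xa psd_carrier[OF psd_kron_list[OF As]]])
        finally show ?thesis .
      qed
      moreover have "?L x a * W * mat_adjoint (?L x a) \<in> carrier_mat (?E x) (?E x)"
        using L[OF xa] L'[OF xa] W by (intro mult_carrier_mat)
      ultimately show ?thesis
        unfolding cyc[OF xa N[OF xa(1)]] using step.IH xa(1) by blast
    qed
    moreover have "mtrace (W * M i) = (\<Sum>(x, a)\<in>?J. mtrace (W * (mat_adjoint (?L x a) * N x i * ?L x a)))"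
      unfolding M
    proof (subst mtrace_mult_msum[OF W])
      fix xa assume "xa \<in> ?J"
      then show "(case xa of (x, a) \<Rightarrow> mat_adjoint (?L x a) * N x i * ?L x a) \<in> carrier_mat ?D ?D"
        using L L' N by (auto intro!: mult_carrier_mat)
    qed (simp add: case_prod_unfold)
    ultimately show "0 \<le> mtrace (W * M i)"
      by (auto intro!: sum_nonneg)
  qed
qed

lemma realizes_locc_block_positive:
  assumes "\<forall>d\<in>set ds. 0 < d" and "W \<in> block_positive ds" and "realizes_locc n ds M" and "i \<le> n"
  shows "0 \<le> mtrace (W * M i)"
proof -
  have "W \<in> carrier_mat (hdim ds) (hdim ds)"
    using assms(2) by (auto simp: block_positive_def hermitian_def)
  moreover have "0 \<le> mtrace (W * kron_list As)" if "list_all2 psd ds As" for As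
    using kron_list_psd_in_SEP[OF assms(1) that] assms(2) by (auto simp: block_positive_def)
  ultimately show ?thesis
    using realizes_locc_pairing_nonneg[OF assms(3,4)] by blast
qed

section \<open>Ensembles\<close>

lemma mtrace_avg_state_mult:
  assumes "ensemble ds n \<eta> \<rho>" and F: "F \<in> carrier_mat (hdim ds) (hdim ds)"
  shows "mtrace (avg_state ds n \<eta> \<rho> * F) = (\<Sum>i=1..n. complex_of_real (\<eta> i) * mtrace (\<rho> i * F))"
proof -
  have carr: "\<rho> i \<in> carrier_mat (hdim ds) (hdim ds)" if "i \<in> {1..n}" for i
    using assms(1) that unfolding ensemble_def state_def by (blast intro: psd_carrier)
  have "mtrace (avg_state ds n \<eta> \<rho> * F) = mtrace (F * avg_state ds n \<eta> \<rho>)"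
    unfolding avg_state_def by (rule mtrace_mult_commute[OF msum_carrier F])
  also have "\<dots> = (\<Sum>i=1..n. mtrace (F * (complex_of_real (\<eta> i) \<cdot>\<^sub>m \<rho> i)))"
    unfolding avg_state_def using carr by (intro mtrace_mult_msum[OF F]) simp
  also have "\<dots> = (\<Sum>i=1..n. complex_of_real (\<eta> i) * mtrace (\<rho> i * F))"
  proof (intro sum.cong refl)
    fix i assume i: "i \<in> {1..n}"
    have "F * (complex_of_real (\<eta> i) \<cdot>\<^sub>m \<rho> i) = complex_of_real (\<eta> i) \<cdot>\<^sub>m (F * \<rho> i)"
      by (rule mult_smult_distrib[OF F carr[OF i]])
    then show "mtrace (F * (complex_of_real (\<eta> i) \<cdot>\<^sub>m \<rho> i)) = complex_of_real (\<eta> i) * mtrace (\<rho> i * F)"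
      using mtrace_smult[OF mult_carrier_mat[OF F carr[OF i]]] mtrace_mult_commute[OF F carr[OF i]] by simp
  qed
  finally show ?thesis .
qed

section \<open>Block positivity and the minimum behind \<open>Q_bound\<close>\<close>

lemma hermitian_lincomb:
  assumes "hermitian d A" "hermitian d B"
  shows "hermitian d (complex_of_real a \<cdot>\<^sub>m A - complex_of_real b \<cdot>\<^sub>m B)"
proof -
  have carr: "A \<in> carrier_mat d d" "B \<in> carrier_mat d d"
    using assms by (auto simp: hermitian_def)
  let ?X = "complex_of_real a \<cdot>\<^sub>m A - complex_of_real b \<cdot>\<^sub>m B"
  have "?X $$ (j, i) = cnj (?X $$ (i, j))" if "i < d" "j < d" for i j
  proof -
    have "A $$ (j, i) = cnj (A $$ (i, j))" "B $$ (j, i) = cnj (B $$ (i, j))"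
      using assms that unfolding hermitian_iff by blast+
    then show ?thesis using carr that by simp
  qed
  moreover have "?X \<in> carrier_mat d d"
    using carr by (intro minus_carrier_mat smult_carrier_mat)
  ultimately show ?thesis
    unfolding hermitian_iff by blast
qed

lemma hermitian_avg_state:
  assumes "ensemble ds n \<eta> \<rho>"
  shows "hermitian (hdim ds) (avg_state ds n \<eta> \<rho>)"
  unfolding hermitian_iff
proof (intro conjI allI impI)
  have \<rho>: "hermitian (hdim ds) (\<rho> i)" if "i \<in> {1..n}" for i
    using assms that by (auto simp: ensemble_def state_def psd_def)
  show "avg_state ds n \<eta> \<rho> \<in> carrier_mat (hdim ds) (hdim ds)" by (simp add: avg_state_def)
  fix a b assume ab: "a < hdim ds" "b < hdim ds"
  have "(complex_of_real (\<eta> i) \<cdot>\<^sub>m \<rho> i) $$ (b, a) = cnj ((complex_of_real (\<eta> i) \<cdot>\<^sub>m \<rho> i) $$ (a, b))"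
    if "i \<in> {1..n}" for i
  proof -
    have "\<rho> i \<in> carrier_mat (hdim ds) (hdim ds)" "\<rho> i $$ (b, a) = cnj (\<rho> i $$ (a, b))"
      using \<rho>[OF that] ab unfolding hermitian_iff by blast+
    then show ?thesis using ab by simp
  qed
  then show "avg_state ds n \<eta> \<rho> $$ (b, a) = cnj (avg_state ds n \<eta> \<rho> $$ (a, b))"
    using ab by (simp add: avg_state_def msum_def)
qed

lemma block_positive_smult:
  assumes "E \<in> block_positive ds" "0 \<le> r"
  shows "complex_of_real r \<cdot>\<^sub>m E \<in> block_positive ds"
proof -
  have E: "hermitian (hdim ds) E" "E \<in> carrier_mat (hdim ds) (hdim ds)"
    using assms(1) by (auto simp: block_positive_def hermitian_def)
  have "complex_of_real r \<cdot>\<^sub>m E - complex_of_real 0 \<cdot>\<^sub>m E = complex_of_real r \<cdot>\<^sub>m E"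
    using E(2) by (intro eq_matI) auto
  then have "hermitian (hdim ds) (complex_of_real r \<cdot>\<^sub>m E)"
    using hermitian_lincomb[OF E(1) E(1), of r 0] by simp
  moreover have "0 \<le> mtrace (complex_of_real r \<cdot>\<^sub>m E * F)" if "F \<in> SEP ds" for F
  proof -
    have F: "F \<in> carrier_mat (hdim ds) (hdim ds)"
      using that by (auto simp: SEP_def intro: psd_carrier)
    have "0 \<le> complex_of_real r * mtrace (E * F)"
      using assms that by (intro mult_nonneg_nonneg) (auto simp: block_positive_def less_eq_complex_def)
    then show ?thesis
      by (simp add: mult_smult_assoc_mat[OF E(2) F] mtrace_smult[OF mult_carrier_mat[OF E(2) F]])
  qed
  ultimately show ?thesis by (simp add: block_positive_def)
qed

text \<open>Each \<open>x\<close> with \<open>0 < t x\<close> confines \<open>q\<close> to a closed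
  half-line. The intersection is nonempty by \<open>q0\<close> and bounded below by
  \<open>x0\<close>, so it contains its infimum and \<open>LEAST\<close> is a genuine
  minimum.\<close>

lemma Least_halflines_le:
  fixes c t :: "'a \<Rightarrow> real"
  assumes t: "\<And>x. x \<in> A \<Longrightarrow> 0 \<le> t x" and "x0 \<in> A" "0 < t x0"
    and q0: "\<And>x. x \<in> A \<Longrightarrow> c x \<le> q0 * t x"
  shows "(LEAST q. \<forall>x\<in>A. c x \<le> q * t x) \<le> q0"
proof -
  let ?S = "{q. \<forall>x\<in>A. c x \<le> q * t x}"
  have bdd: "bdd_below ?S"
    using \<open>x0 \<in> A\<close> \<open>0 < t x0\<close> by (intro bdd_belowI[of _ "c x0 / t x0"]) (auto simp: field_simps)
  have ne: "q0 \<in> ?S" using q0 by simp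
  have "c x \<le> Inf ?S * t x" if "x \<in> A" for x
  proof (cases "t x = 0")
    \<comment> \<open>Here the constraint does not depend on \<open>q\<close>, so its validity at
      \<open>q0\<close> settles it.\<close>
    case True
    then show ?thesis using q0[OF that] by simp
  next
    case False
    then have "0 < t x" using t[OF that] by simp
    then have "c x / t x \<le> Inf ?S"
      using ne that by (intro cInf_greatest) (auto simp: field_simps)
    then show ?thesis using \<open>0 < t x\<close> by (simp add: field_simps)
  qed
  then have "(LEAST q. \<forall>x\<in>A. c x \<le> q * t x) = Inf ?S"
    using bdd by (intro Least_equality) (auto intro: cInf_lower)
  also have "\<dots> \<le> q0" using bdd ne by (intro cInf_lower)
  finally show ?thesis .
qed

lemma Q_bound_le:
  assumes ds: "\<forall>d\<in>set ds. 0 < d" and ens: "ensemble ds n \<eta> \<rho>" and j: "j \<in> {1..n}"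
    and q0: "complex_of_real q0 \<cdot>\<^sub>m avg_state ds n \<eta> \<rho> - complex_of_real (\<eta> j) \<cdot>\<^sub>m \<rho> j \<in> block_positive ds"
  shows "Q_bound ds n \<eta> \<rho> j \<le> q0"
proof -
  let ?D = "hdim ds" and ?R = "avg_state ds n \<eta> \<rho>"
  let ?X = "\<lambda>q. complex_of_real q \<cdot>\<^sub>m ?R - complex_of_real (\<eta> j) \<cdot>\<^sub>m \<rho> j"
  let ?c = "\<lambda>F. \<eta> j * Re (mtrace (\<rho> j * F))" and ?t = "\<lambda>F. Re (mtrace (?R * F))"
  have \<rho>: "0 < \<eta> i" "psd ?D (\<rho> i)" if "i \<in> {1..n}" for i
    using ens that by (auto simp: ensemble_def state_def)
  have R: "?R \<in> carrier_mat ?D ?D" by (simp add: avg_state_def)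
  note \<rho>j = psd_carrier[OF \<rho>(2)[OF j]]
  have SEP: "psd ?D F" if "F \<in> SEP ds" for F
    using that by (simp add: SEP_def)
  have t: "0 \<le> mtrace (?R * F)" if F: "F \<in> SEP ds" for F
    unfolding mtrace_avg_state_mult[OF ens psd_carrier[OF SEP[OF F]]]
    using mtrace_psd_mult_nonneg[OF \<rho>(2) SEP[OF F]] \<rho>(1)
    by (intro sum_nonneg mult_nonneg_nonneg) (auto simp: less_eq_complex_def less_imp_le)
  have X: "mtrace (?X q * F) = complex_of_real q * mtrace (?R * F) - complex_of_real (\<eta> j) * mtrace (\<rho> j * F)"
    if F: "F \<in> SEP ds" for q F
  proof -
    note F' = psd_carrier[OF SEP[OF F]]
    have "?X q * F = complex_of_real q \<cdot>\<^sub>m (?R * F) - complex_of_real (\<eta> j) \<cdot>\<^sub>m (\<rho> j * F)"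
      using minus_mult_distrib_mat[OF smult_carrier_mat[OF R] smult_carrier_mat[OF \<rho>j] F']
        mult_smult_assoc_mat[OF R F'] mult_smult_assoc_mat[OF \<rho>j F'] by simp
    then show ?thesis
      using mtrace_minus[OF smult_carrier_mat[OF mult_carrier_mat[OF R F']] smult_carrier_mat[OF mult_carrier_mat[OF \<rho>j F']]]
        mtrace_smult[OF mult_carrier_mat[OF R F']] mtrace_smult[OF mult_carrier_mat[OF \<rho>j F']] by simp
  qed
  \<comment> \<open>Block positivity becomes a family of real inequalities linear in
    \<open>q\<close>. The order on complex numbers also demands a vanishing imaginary part, which is
    supplied by both traces being nonnegative and hence real.\<close>
  have mem: "?X q \<in> block_positive ds \<longleftrightarrow> (\<forall>F\<in>SEP ds. ?c F \<le> q * ?t F)" for q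
  proof -
    have "hermitian ?D (?X q)"
      using hermitian_avg_state[OF ens] \<rho>(2)[OF j] by (intro hermitian_lincomb) (auto simp: psd_def)
    moreover have "0 \<le> mtrace (?X q * F) \<longleftrightarrow> ?c F \<le> q * ?t F" if F: "F \<in> SEP ds" for F
      using t[OF F] mtrace_psd_mult_nonneg[OF \<rho>(2)[OF j] SEP[OF F]]
      unfolding X[OF F] by (auto simp: less_eq_complex_def)
    ultimately show ?thesis by (auto simp: block_positive_def)
  qed
  \<comment> \<open>The average state has trace 1, so the identity is a test operator with positive
    slope in \<open>q\<close>.\<close>
  have "mtrace (?R * 1\<^sub>m ?D) = (\<Sum>i=1..n. complex_of_real (\<eta> i) * mtrace (\<rho> i * 1\<^sub>m ?D))"
    by (rule mtrace_avg_state_mult[OF ens]) simp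
  also have "\<dots> = (\<Sum>i=1..n. complex_of_real (\<eta> i))"
  proof (intro sum.cong refl)
    fix i assume i: "i \<in> {1..n}"
    have "mtrace (\<rho> i) = 1" using ens i by (simp add: ensemble_def state_def)
    then show "complex_of_real (\<eta> i) * mtrace (\<rho> i * 1\<^sub>m ?D) = complex_of_real (\<eta> i)"
      using psd_carrier[OF \<rho>(2)[OF i]] by simp
  qed
  also have "\<dots> = 1" using ens by (simp add: ensemble_def flip: of_real_sum)
  finally have one: "?t (1\<^sub>m ?D) = 1" by simp
  have "(LEAST q. \<forall>F\<in>SEP ds. ?c F \<le> q * ?t F) \<le> q0"
  proof (rule Least_halflines_le)
    show "0 \<le> ?t F" if "F \<in> SEP ds" for F using t[OF that] by (simp add: less_eq_complex_def)
    show "1\<^sub>m ?D \<in> SEP ds" by (rule one_in_SEP[OF ds])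
    show "0 < ?t (1\<^sub>m ?D)" by (simp add: one)
    show "?c F \<le> q0 * ?t F" if "F \<in> SEP ds" for F using q0 mem that by blast
  qed
  then show ?thesis unfolding Q_bound_def mem .
qed

text \<open>The remainder \<open>1 - c A\<close> is assigned to the inconclusive outcome 0, and
  outcomes above 1 get the zero operator.\<close>

lemma measurement_psd_smult:
  assumes "psd (hdim ds) A" and "0 < n"
  obtains c :: real and M where "0 < c" "measurement ds n M" "M 1 = complex_of_real c \<cdot>\<^sub>m A"
proof -
  obtain c :: real where c: "0 < c" "psd (hdim ds) (1\<^sub>m (hdim ds) - complex_of_real c \<cdot>\<^sub>m A)"
    using psd_one_minus_smult[OF assms(1)] .
  let ?D = "hdim ds" and ?cA = "complex_of_real c \<cdot>\<^sub>m A"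
  define M where "M i = (if i = 0 then 1\<^sub>m ?D - ?cA else if i = 1 then ?cA else 0\<^sub>m ?D ?D)" for i :: nat
  have carr: "A \<in> carrier_mat ?D ?D" using assms(1) by (rule psd_carrier)
  have "psd ?D ?cA"
    using assms(1) c(1) by (intro psd_smult) (auto simp: less_eq_complex_def)
  then have "psd ?D (M i)" for i
    using c(2) by (simp add: M_def)
  moreover have "msum ?D ?D {..n} M = 1\<^sub>m ?D"
  proof (intro eq_matI)
    fix a b assume "a < dim_row (1\<^sub>m ?D :: complex mat)" "b < dim_col (1\<^sub>m ?D :: complex mat)"
    then have ab: "a < ?D" "b < ?D" by simp_all
    have "(\<Sum>i\<le>n. M i $$ (a, b)) = (\<Sum>i\<in>{0, 1}. M i $$ (a, b))"
      using \<open>0 < n\<close> ab by (intro sum.mono_neutral_right) (auto simp: M_def)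
    also have "\<dots> = 1\<^sub>m ?D $$ (a, b)"
      using ab carr by (simp add: M_def)
    finally show "msum ?D ?D {..n} M $$ (a, b) = 1\<^sub>m ?D $$ (a, b)"
      using ab by (simp add: msum_def)
  qed (simp_all add: msum_def)
  ultimately have "measurement ds n M" by (simp add: measurement_def)
  then show thesis using that c(1) by (simp add: M_def)
qed

theorem mainTheorem6:
  fixes ds :: "nat list" and W Wp Wm :: "complex mat"
    and \<eta> :: "nat \<Rightarrow> real" and \<rho> :: "nat \<Rightarrow> complex mat"
  assumes "2 \<le> length ds" and "\<forall>d\<in>set ds. 0 < d"
    and "entanglement_witness ds W"
    and "psd (hdim ds) Wp" and "psd (hdim ds) Wm"
    and "Wp * Wm = 0\<^sub>m (hdim ds) (hdim ds)"
    and "W = Wp - Wm"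
    and "\<eta> 1 = Re (mtrace Wm) / (Re (mtrace Wp) + Re (mtrace Wm))"
    and "\<rho> 1 = (1 / mtrace Wm) \<cdot>\<^sub>m Wm"
    and "\<eta> 2 = Re (mtrace Wp) / (Re (mtrace Wp) + Re (mtrace Wm))"
    and "\<rho> 2 = (1 / mtrace Wp) \<cdot>\<^sub>m Wp"
  shows "ensemble ds 2 \<eta> \<rho> \<and> \<rho> 1 * \<rho> 2 = 0\<^sub>m (hdim ds) (hdim ds)
    \<and> Q_bound ds 2 \<eta> \<rho> 1 \<le> 1 / 2 \<and> 1 / 2 < max_confidence ds 2 \<eta> \<rho> 1
    \<and> max_confidence ds 2 \<eta> \<rho> 1 = 1
    \<and> nonlocal_max_confidence ds 2 \<eta> \<rho> 1"
proof -
  let ?D = "hdim ds"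
  define p q where "p = Re (mtrace Wp)" and "q = Re (mtrace Wm)"
  have Wp: "Wp \<in> carrier_mat ?D ?D" and Wm: "Wm \<in> carrier_mat ?D ?D"
    using assms(4,5) by (auto intro: psd_carrier)
  have p: "mtrace Wp = of_real p" and q: "mtrace Wm = of_real q" "0 \<le> q"
    using assms(4,5)[THEN mtrace_psd_nonneg] by (auto simp: p_def q_def less_eq_complex_def complex_eq_iff)
  have BP: "W \<in> block_positive ds" and not_psd: "\<not> psd ?D W"
    using assms(3) by (auto simp: entanglement_witness_def)
  have W: "W \<in> carrier_mat ?D ?D" unfolding assms(7) by (rule minus_carrier_mat[OF Wm])
  have "q \<noteq> 0"
  proof
    assume "q = 0"
    then have "Wm = 0\<^sub>m ?D ?D" using psd_mtrace_zero[OF assms(5)] q by simp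
    then have "W = Wp" using assms(7) Wp by (auto intro!: eq_matI)
    then show False using not_psd assms(4) by simp
  qed
  with q have "0 < q" by simp
  \<comment> \<open>Testing \<open>W\<close> on the identity compares the two traces; this is what
    makes \<open>p\<close> positive and the second state well defined.\<close>
  have "0 \<le> mtrace (W * 1\<^sub>m ?D)"
    using BP one_in_SEP[OF assms(2)] by (auto simp: block_positive_def)
  also have "\<dots> = of_real (p - q)"
    using W Wp Wm p q by (simp add: assms(7) mtrace_minus)
  finally have "q \<le> p" by (simp add: less_eq_complex_def)
  with \<open>0 < q\<close> have "0 < p" by simp
  define T where "T = p + q"
  have "0 < T" using \<open>0 < p\<close> \<open>0 < q\<close> by (simp add: T_def)
  have \<eta>: "\<eta> 1 = q / T" "\<eta> 2 = p / T"
    using assms(8,10) by (simp_all add: p_def q_def T_def)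
  have \<rho>: "\<rho> 1 = (1 / of_real q) \<cdot>\<^sub>m Wm" "\<rho> 2 = (1 / of_real p) \<cdot>\<^sub>m Wp"
    using assms(9,11) p q by simp_all
  have two: "{1..2} = {1, 2 :: nat}" by auto

  have "state ?D (\<rho> 1)" "state ?D (\<rho> 2)"
    using assms(4,5) \<open>0 < p\<close> \<open>0 < q\<close> p q Wp Wm unfolding \<rho> state_def
    by (auto simp: mtrace_smult less_eq_complex_def intro!: psd_smult)
  then have ens: "ensemble ds 2 \<eta> \<rho>"
    using \<open>0 < p\<close> \<open>0 < q\<close> \<open>0 < T\<close> unfolding ensemble_def two
    by (simp add: \<eta> T_def add_divide_distrib[symmetric] del: One_nat_def)

  \<comment> \<open>Orthogonality is assumed in the other order; taking adjoints reverses
    it.\<close>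
  have "Wm * Wp = mat_adjoint (Wp * Wm)"
    using assms(4,5) Wp Wm by (simp add: mat_adjoint_mult psd_def hermitian_def)
  also have "\<dots> = 0\<^sub>m ?D ?D" unfolding assms(6) by (intro eq_matI) auto
  finally have WmWp: "Wm * Wp = 0\<^sub>m ?D ?D" .
  have orth: "\<rho> 1 * \<rho> 2 = 0\<^sub>m ?D ?D"
    unfolding \<rho> using mult_smult_assoc_mat[OF Wm smult_carrier_mat[OF Wp]] mult_smult_distrib[OF Wm Wp] WmWp
    by simp

  have "complex_of_real (1 / 2) \<cdot>\<^sub>m avg_state ds 2 \<eta> \<rho> - complex_of_real (\<eta> 1) \<cdot>\<^sub>m \<rho> 1
      = complex_of_real (1 / (2 * T)) \<cdot>\<^sub>m W"
    using Wp Wm \<open>0 < p\<close> \<open>0 < q\<close> \<open>0 < T\<close> unfolding assms(7) avg_state_def two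
    by (intro eq_matI) (auto simp: msum_def \<eta> \<rho> field_simps simp del: One_nat_def)
  also have "\<dots> \<in> block_positive ds"
    using BP \<open>0 < T\<close> by (intro block_positive_smult) auto
  finally have Q: "Q_bound ds 2 \<eta> \<rho> 1 \<le> 1 / 2"
    by (intro Q_bound_le[OF assms(2) ens]) auto

  have num: "mtrace (\<rho> 1 * F) = mtrace (Wm * F) / of_real q"
    and num2: "mtrace (\<rho> 2 * F) = mtrace (Wp * F) / of_real p"
    if "F \<in> carrier_mat ?D ?D" for F
    unfolding \<rho> using mult_smult_assoc_mat[OF Wm that] mult_smult_assoc_mat[OF Wp that]
      mtrace_smult[OF mult_carrier_mat[OF Wm that]] mtrace_smult[OF mult_carrier_mat[OF Wp that]] by simp_all
  have den: "mtrace (avg_state ds 2 \<eta> \<rho> * F) = (mtrace (Wp * F) + mtrace (Wm * F)) / of_real T"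
    if "F \<in> carrier_mat ?D ?D" for F
    using mtrace_avg_state_mult[OF ens that] \<open>0 < p\<close> \<open>0 < q\<close>
    by (simp add: two \<eta> num[OF that] num2[OF that] add_divide_distrib del: One_nat_def)

  \<comment> \<open>The factors \<open>q\<close> and \<open>T\<close> cancel, so all estimates below
    concern two nonnegative reals. The last conjunct separates true confidences from the value
    produced by division by zero.\<close>
  have conf: "\<exists>a b. 0 \<le> a \<and> 0 \<le> b \<and> mtrace (Wp * M 1) = of_real a \<and> mtrace (Wm * M 1) = of_real b
      \<and> confidence ds 2 \<eta> \<rho> 1 M = b / (a + b)
      \<and> (mtrace (avg_state ds 2 \<eta> \<rho> * M 1) \<noteq> 0 \<longleftrightarrow> a + b \<noteq> 0)" if "measurement ds 2 M" for M
  proof -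
    have M: "psd ?D (M 1)" using that by (simp add: measurement_def)
    note MC = psd_carrier[OF M]
    define a b where "a = Re (mtrace (Wp * M 1))" and "b = Re (mtrace (Wm * M 1))"
    have ab: "mtrace (Wp * M 1) = of_real a" "mtrace (Wm * M 1) = of_real b" "0 \<le> a" "0 \<le> b"
      using mtrace_psd_mult_nonneg[OF assms(4) M] mtrace_psd_mult_nonneg[OF assms(5) M]
      by (auto simp: a_def b_def less_eq_complex_def complex_eq_iff)
    have "confidence ds 2 \<eta> \<rho> 1 M = b / (a + b)"
      unfolding confidence_def num[OF MC] den[OF MC] ab \<eta>
      using \<open>0 < q\<close> \<open>0 < T\<close> by (simp flip: of_real_add of_real_divide)
    moreover have "mtrace (avg_state ds 2 \<eta> \<rho> * M 1) \<noteq> 0 \<longleftrightarrow> a + b \<noteq> 0"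
      unfolding den[OF MC] ab using \<open>0 < T\<close> by (simp flip: of_real_add of_real_divide)
    ultimately show ?thesis using ab by blast
  qed

  obtain c :: real and M where M: "0 < c" "measurement ds 2 M" "M 1 = complex_of_real c \<cdot>\<^sub>m Wm"
    using measurement_psd_smult[OF assms(5), of 2] by auto
  have M_conf: "mtrace (avg_state ds 2 \<eta> \<rho> * M 1) \<noteq> 0" "confidence ds 2 \<eta> \<rho> 1 M = 1"
  proof -
    \<comment> \<open>The chosen operator must give a nonzero denominator. Orthogonality removes the
      \<open>Wp\<close> part, and the remaining part is \<open>c\<close> times the squared Frobenius
      norm of \<open>Wm\<close>.\<close>
    have "Wm \<noteq> 0\<^sub>m ?D ?D" using q \<open>q \<noteq> 0\<close> by (auto simp: mtrace_def)
    then have "mtrace (Wm * Wm) \<noteq> 0"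
      using hermitian_mtrace_square_zero assms(5) by (auto simp: psd_def)
    then have "mtrace (Wm * M 1) \<noteq> 0"
      unfolding M(3) using M(1) mult_smult_distrib[OF Wm Wm] mtrace_smult[OF mult_carrier_mat[OF Wm Wm]] by simp
    moreover have "mtrace (Wp * M 1) = 0"
      unfolding M(3) using mult_smult_distrib[OF Wp Wm] by (simp add: assms(6) mtrace_def)
    ultimately show "mtrace (avg_state ds 2 \<eta> \<rho> * M 1) \<noteq> 0" "confidence ds 2 \<eta> \<rho> 1 M = 1"
      using conf[OF M(2)] by auto
  qed
  have max: "max_confidence ds 2 \<eta> \<rho> 1 = 1"
    unfolding max_confidence_def
  proof (rule Greatest_equality)
    show "\<exists>M. measurement ds 2 M \<and> mtrace (avg_state ds 2 \<eta> \<rho> * M 1) \<noteq> 0 \<and> 1 = confidence ds 2 \<eta> \<rho> 1 M"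
      using M(2) M_conf by metis
    fix y
    assume "\<exists>M. measurement ds 2 M \<and> mtrace (avg_state ds 2 \<eta> \<rho> * M 1) \<noteq> 0 \<and> y = confidence ds 2 \<eta> \<rho> 1 M"
    then obtain M' a b where "0 \<le> a" "0 \<le> b" "y = b / (a + b)" "a + b \<noteq> 0"
      using conf by metis
    then show "y \<le> 1" by (simp add: divide_le_eq)
  qed

  have locc: "confidence ds 2 \<eta> \<rho> 1 M \<le> 1 / 2"
    if LM: "locc_measurement ds 2 M" and nz: "mtrace (avg_state ds 2 \<eta> \<rho> * M 1) \<noteq> 0" for M
  proof -
    have meas: "measurement ds 2 M" and real: "realizes_locc 2 ds M"
      using LM by (auto simp: locc_measurement_def)
    have MC: "M 1 \<in> carrier_mat ?D ?D"
      using meas by (auto simp: measurement_def intro: psd_carrier)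
    obtain a b where ab: "0 \<le> a" "0 \<le> b" "mtrace (Wp * M 1) = of_real a" "mtrace (Wm * M 1) = of_real b"
      "confidence ds 2 \<eta> \<rho> 1 M = b / (a + b)" "a + b \<noteq> 0"
      using conf[OF meas] nz by blast
    have "0 \<le> mtrace (W * M 1)"
      by (rule realizes_locc_block_positive[OF assms(2) BP real]) simp
    also have "W * M 1 = Wp * M 1 - Wm * M 1"
      unfolding assms(7) by (rule minus_mult_distrib_mat[OF Wp Wm MC])
    also have "mtrace \<dots> = of_real (a - b)"
      using mtrace_minus[OF mult_carrier_mat[OF Wp MC] mult_carrier_mat[OF Wm MC]] ab by simp
    finally have "b \<le> a" by (simp add: less_eq_complex_def)
    then show ?thesis using ab by (simp add: divide_le_eq)
  qed
  \<comment> \<open>The supremum over LOCC measurements can be bounded only if the set is nonempty.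
    The protocol that always announces outcome 1 belongs to it, its denominator being the trace of
    the average state.\<close>
  define M1 where "M1 i = (if i = 1 then 1\<^sub>m ?D else 0\<^sub>m ?D ?D :: complex mat)" for i :: nat
  have "msum ?D ?D {..2} M1 = 1\<^sub>m ?D"
    by (intro eq_matI) (auto simp: msum_def M1_def numeral_2_eq_2)
  then have "measurement ds 2 M1"
    by (simp add: measurement_def M1_def)
  moreover have "realizes_locc 2 ds M1"
    by (rule realizes_locc.stop[of 1]) (auto simp: M1_def)
  ultimately have M1: "locc_measurement ds 2 M1" by (simp add: locc_measurement_def)
  have "mtrace (avg_state ds 2 \<eta> \<rho> * M1 1) = 1"
    using den[of "1\<^sub>m ?D"] Wp Wm p q \<open>0 < T\<close> by (simp add: M1_def T_def flip: of_real_add)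
  then have "locc_max_confidence ds 2 \<eta> \<rho> 1 \<le> 1 / 2"
    unfolding locc_max_confidence_def using M1 locc by (intro cSup_least) force+
  then show ?thesis
    using ens orth Q max by (simp add: nonlocal_max_confidence_def)
qed

end
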